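(* Consider the multicolored multiple-drawing randomly reinforced urn described in the context. Assume: (A1) there is a constant $C_2$ such that $\sup_n \mathbb{E}(A_{nk}^3)<C_2$ for all $k\in\{1,\dots,d\}$; (A2) for all $k\in\{1,\dots,d\}$, $m_{nk}:=\mathbb{E}(A_{nk})\to m_k$ as $n\to\infty$, where $m_1,\dots,m_d$ are finite reals with $m_1=\dots=m_t>m_{t+1}\ge m_{t+2}\ge\dots\ge m_d$ for some $t\in\{1,\dots,d\}$; moreover $m_{n1}=m_{n2}=\dots=m_{nt}$ for all $n\ge 1$; (A3) for all $k,j\in\{1,\dots,d\}$, $\sum_{n=1}^\infty \frac{|m_{n+1,k}m_j-m_km_{n+1,j}|}{n}<\infty$; (N) $\mathbb E(N_{n+1}\mid\mathcal F_n)\to N$ almost surely, for some random variable $N$. Let $Z_k$ be the almost sure limit of $Z_{nk}$ and, for $j\in\{t+1,\dots,d\}$, let $\xi_{j1}\in(0,\infty)$ be the almost sure limit of $H_{nj}/H_{n1}^{m_j/m_1}$. Then, as $n\to\infty$: (i) For all $j\in\{t+1,\dots,d\}$ there exists a random variable $\tilde Z_j$ such that $n^{1-m_j/m_1}Z_{nj}\to\tilde Z_j$ almost surely, where almost surely $$\tilde Z_j=\frac{\xi_{j1}Z_1^{m_j/m_1}}{(Nm_1)^{1-m_j/m_1}},$$ and $\mathbb P(\tilde Z_j\in(0,+\infty))=1$. (ii) For all $j\in\{t+1,\dots,d\}$, $\dfrac{H_{nj}}{n^{m_j/m_1}}\to (Nm_1Z_1)^{m_j/m_1}\xi_{j1}$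 almost surely. (iii) For all $k\in\{1,\dots,d\}$, almost surely $$\frac{N_{A_k,n}}{n^{m_k/m_1}}=\frac1{n^{m_k/m_1}}\sum_{j=1}^nX_{jk}\to\begin{cases}NZ_k,&k\in\{1,\dots,t\},\\[2pt] \frac{m_1}{m_k}N\tilde Z_k,&k\in\{t+1,\dots,d\}.\end{cases}$$
   Context: Urn model. An urn contains balls of $d\ge 2$ colors. The initial composition is a deterministic vector $\mathbf H_0=(H_{01},\dots,H_{0d})^\top$ of positive integers. At each stage $n\ge1$, a random number $N_n$ of balls is drawn without replacement; $\mathbf X_n=(X_{n1},\dots,X_{nd})^\top$ records how many balls of each color are drawn, so $\sum_k X_{nk}=N_n$. The drawn balls are then returned together with $A_{nk}X_{nk}$ new balls of color $k$, for each $k$. Here $\mathbf R_n=\mathrm{diag}(A_{n1},\dots,A_{nd})$ is the random replacement matrix. So $H_{nk}=H_{0k}+\sum_{i=1}^n A_{ik}X_{ik}$, $S_n=\sum_{k=1}^d H_{nk}$ and $Z_{nk}=H_{nk}/S_n$; $N_{A_k,n}=\sum_{j=1}^nX_{jk}$ is the number of color-$k$ balls drawn in the first $n$ stages. Let $\mathcal F_0$ be trivial, $\mathcal F_n=\sigma\{N_1,\mathbf X_1,\mathbf R_1,\dots,N_n,\mathbf X_n,\mathbf R_n\}$ and $\mathcal G_n=\sigma(\mathcal F_n,N_{n+1})$. Standing assumptions, for all $n\ge0$: (I) $N_{n+1}$ takes values in $\{1,2,\dots,\min(S_n,C_1)\}$ for some constant positive integer $C_1$. (II) Conditionally on $\mathcal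 G_n$, $\mathbf X_{n+1}$ is multivariate hypergeometric with parameters $(S_n,N_{n+1},\mathbf H_n)$: $\mathbb P(\mathbf X_{n+1}=\mathbf x\mid\mathcal G_n)=\prod_{k=1}^d\binom{H_{nk}}{x_k}\big/\binom{S_n}{N_{n+1}}$ for integer vectors $\mathbf x$ with $0\le x_k\le H_{nk}$ and $\sum_k x_k=N_{n+1}$. (III) Each $A_{n+1,k}$ takes (integer) values in $[1,\infty)$, and $\mathbf R_{n+1}$ is independent of $\sigma(\mathcal G_n,\mathbf X_{n+1})$. The components of $\mathbf R_{n+1}$ may be correlated with each other. Under the hypotheses of the claim, the almost sure limits $Z_k=\lim_n Z_{nk}$ ($k=1,\dots,d$) and $\xi_{j1}=\lim_n H_{nj}/H_{n1}^{m_j/m_1}\in(0,\infty)$ exist. *)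

theory Defs
  imports "HOL-Probability.Probability"
begin

(* Colours are the indices 1, ..., d and stages are 1, 2, ...; values of the model functions at
   other indices are irrelevant. A n k stands for the k-th diagonal entry of the replacement
   matrix R_n, and D n for the number N_n of balls drawn at stage n. *)

definition urn_H ::
  "(nat \<Rightarrow> nat) \<Rightarrow> (nat \<Rightarrow> nat \<Rightarrow> 'a \<Rightarrow> nat) \<Rightarrow> (nat \<Rightarrow> nat \<Rightarrow> 'a \<Rightarrow> nat) \<Rightarrow> nat \<Rightarrow> nat \<Rightarrow> 'a \<Rightarrow> nat" where
  "urn_H H0 X A n k \<omega> = H0 k + (\<Sum>i=1..n. A i k \<omega> * X i k \<omega>)"

definition urn_S ::
  "nat \<Rightarrow> (nat \<Rightarrow> nat) \<Rightarrow> (nat \<Rightarrow> nat \<Rightarrow> 'a \<Rightarrow> nat) \<Rightarrow> (nat \<Rightarrow> nat \<Rightarrow> 'a \<Rightarrow> nat) \<Rightarrow> nat \<Rightarrow> 'a \<Rightarrow> nat" where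
  "urn_S d H0 X A n \<omega> = (\<Sum>k=1..d. urn_H H0 X A n k \<omega>)"

definition urn_Z ::
  "nat \<Rightarrow> (nat \<Rightarrow> nat) \<Rightarrow> (nat \<Rightarrow> nat \<Rightarrow> 'a \<Rightarrow> nat) \<Rightarrow> (nat \<Rightarrow> nat \<Rightarrow> 'a \<Rightarrow> nat) \<Rightarrow> nat \<Rightarrow> nat \<Rightarrow> 'a \<Rightarrow> real" where
  "urn_Z d H0 X A n k \<omega> = real (urn_H H0 X A n k \<omega>) / real (urn_S d H0 X A n \<omega>)"

definition urn_drawn :: "(nat \<Rightarrow> nat \<Rightarrow> 'a \<Rightarrow> nat) \<Rightarrow> nat \<Rightarrow> nat \<Rightarrow> 'a \<Rightarrow> nat" where
  "urn_drawn X n k \<omega> = (\<Sum>j=1..n. X j k \<omega>)"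

definition repl_mean :: "'a measure \<Rightarrow> (nat \<Rightarrow> nat \<Rightarrow> 'a \<Rightarrow> nat) \<Rightarrow> nat \<Rightarrow> nat \<Rightarrow> real" where
  "repl_mean M A n k = (\<integral>\<omega>. real (A n k \<omega>) \<partial>M)"

definition rv_events :: "'a measure \<Rightarrow> ('a \<Rightarrow> nat) \<Rightarrow> 'a set set" where
  "rv_events M f = sets (vimage_algebra (space M) f (count_space UNIV))"

definition vec_events :: "'a measure \<Rightarrow> nat \<Rightarrow> (nat \<Rightarrow> 'a \<Rightarrow> nat) \<Rightarrow> 'a set set" where
  "vec_events M d V = (\<Union>k\<in>{1..d}. rv_events M (V k))"

definition urn_F ::
  "'a measure \<Rightarrow> nat \<Rightarrow> (nat \<Rightarrow> 'a \<Rightarrow> nat) \<Rightarrow> (nat \<Rightarrow> nat \<Rightarrow> 'a \<Rightarrow> nat) \<Rightarrow> (nat \<Rightarrow> nat \<Rightarrow> 'a \<Rightarrow> nat) \<Rightarrow> nat \<Rightarrow> 'a measure" where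
  "urn_F M d D X A n = sigma (space M)
     (\<Union>i\<in>{1..n}. rv_events M (D i) \<union> vec_events M d (X i) \<union> vec_events M d (A i))"

definition urn_G ::
  "'a measure \<Rightarrow> nat \<Rightarrow> (nat \<Rightarrow> 'a \<Rightarrow> nat) \<Rightarrow> (nat \<Rightarrow> nat \<Rightarrow> 'a \<Rightarrow> nat) \<Rightarrow> (nat \<Rightarrow> nat \<Rightarrow> 'a \<Rightarrow> nat) \<Rightarrow> nat \<Rightarrow> 'a measure" where
  "urn_G M d D X A n = sigma (space M) (sets (urn_F M d D X A n) \<union> rv_events M (D (n + 1)))"

(* Probability of the colour counts x 1, ..., x d when N balls are drawn without replacement from
   an urn holding h k balls of colour k. *)
definition mv_hypergeometric :: "nat \<Rightarrow> (nat \<Rightarrow> nat) \<Rightarrow> nat \<Rightarrow> (nat \<Rightarrow> nat) \<Rightarrow> real" where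
  "mv_hypergeometric d h N x =
     (if (\<forall>k\<in>{1..d}. x k \<le> h k) \<and> (\<Sum>k=1..d. x k) = N
      then (\<Prod>k=1..d. real (h k choose x k)) / real ((\<Sum>k=1..d. h k) choose N)
      else 0)"

locale reinforced_urn = prob_space M
  for M :: "'a measure" and d :: nat and H0 :: "nat \<Rightarrow> nat" and D :: "nat \<Rightarrow> 'a \<Rightarrow> nat"
    and X A :: "nat \<Rightarrow> nat \<Rightarrow> 'a \<Rightarrow> nat" and C1 :: nat +
  assumes colours: "2 \<le> d"
    and initial: "\<forall>k\<in>{1..d}. 0 < H0 k"
    and D_rv: "\<forall>n\<ge>1. D n \<in> measurable M (count_space UNIV)"
    and X_rv: "\<forall>n\<ge>1. \<forall>k\<in>{1..d}. X n k \<in> measurable M (count_space UNIV)"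
    and A_rv: "\<forall>n\<ge>1. \<forall>k\<in>{1..d}. A n k \<in> measurable M (count_space UNIV)"
    and X_total: "\<forall>n\<ge>1. \<forall>\<omega>\<in>space M. (\<Sum>k=1..d. X n k \<omega>) = D n \<omega>"
    and C1_pos: "0 < C1"
    and D_range: "\<forall>n. \<forall>\<omega>\<in>space M. D (n + 1) \<omega> \<in> {1..min (urn_S d H0 X A n \<omega>) C1}"
    and X_cond: "\<forall>n x. AE \<omega> in M.
      real_cond_exp M (urn_G M d D X A n)
        (indicator {\<omega> \<in> space M. \<forall>k\<in>{1..d}. X (n + 1) k \<omega> = x k}) \<omega>
      = mv_hypergeometric d (\<lambda>k. urn_H H0 X A n k \<omega>) (D (n + 1) \<omega>) x"
    and A_range: "\<forall>n. \<forall>k\<in>{1..d}. \<forall>\<omega>\<in>space M. 1 \<le> A (n + 1) k \<omega>"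
    and A_indep: "\<forall>n. indep_set
      (sigma_sets (space M) (vec_events M d (A (n + 1))))
      (sigma_sets (space M) (sets (urn_G M d D X A n) \<union> vec_events M d (X (n + 1))))"

end

theory Submission
  imports Defs "HOL-Computational_Algebra.Polynomial"
begin

text \<open>
  \<^bold>\<open>Why the limits exist.\<close> Write $H_n^k$ for the number of balls of colour $k$, $S_n$ for the total, and
  $m_{n,k}$ for the mean of the replacement factor $A_{n,k}$. The relative increment
  $A_{n+1,k} X_{n+1,k} / H_n^k$ has conditional mean $m_{n+1,k} N_{n+1} / S_n$ given the past and
  $N_{n+1}$, in which the colour enters only through $m_{n+1,k}$. Its fluctuation splits into
  $(A_{n+1,k} - m_{n+1,k}) X_{n+1,k} / H_n^k$, due to the replacement, and
  $m_{n+1,k} (X_{n+1,k} / H_n^k - N_{n+1} / S_n)$, due to the draw. Both are martingale differences.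
  Because the factors are at least 1 and the draws bounded, $\sum_n (X_{n+1,k} / H_n^k)^2$ is bounded by a
  constant on every path: compare with the telescoping sum of $1 / H_n^k - 1 / H_{n+1}^k$
  (\<open>sum_X_sq_over_H_sq_le\<close>). With bounded second moments of the factors both martingales are bounded
  in mean square and converge almost surely (\<open>martingale_differences_summable\<close>), and the squared
  relative increments are almost surely summable. Hence
  $\ln H_n^k - \sum_{i<n} m_{i+1,k} N_{i+1} / S_i$ converges. Since $S_n \ge n$, the summability of
  $|m_{n+1,k} m_j - m_k m_{n+1,j}| / n$ makes the compensators of two colours, divided by $m_k$ and
  $m_j$, differ by a convergent series. So $\ln H_n^k / m_k - \ln H_n^j / m_j$ converges, that is, $H_n^j / (H_n^1)^{m_j / m_1}$ has a limit in
  $(0, \infty)$ (\<open>h_ratio_limit\<close>). All counts tend to infinity; colours with maximal mean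
  have comparable counts, the others are negligible, and the limits of the proportions follow.

  \<^bold>\<open>Why the rates are as claimed.\<close> Kronecker's lemma applied to the replacement fluctuations
  shows that the number of draws of colour $k$ divided by $H_n^k$ tends to $1 / m_k$
  (\<open>drawn_over_h\<close>). The same lemma applied to the third martingale, with differences
  $(N_{n+1} - E(N_{n+1} | F_n)) / (n+1)$, shows that the average number of balls drawn per stage tends to
  $N$ (\<open>D_average\<close>). Summing the draws over all colours relates the two and yields
  $H_n^1 / n \to N m_1 Z_1$; the remaining limits are algebra (\<open>limits\<close>).
\<close>

section \<open>Averages and Kronecker's lemma\<close>

lemma weighted_cesaro:
  fixes w y :: "nat \<Rightarrow> real"
  assumes w: "\<And>n. 0 \<le> w n" and W: "filterlim (\<lambda>n. \<Sum>i<n. w i) at_top sequentially"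
    and y: "y \<longlonglongrightarrow> l"
  shows "(\<lambda>n. (\<Sum>i<n. w i * y i) / (\<Sum>i<n. w i)) \<longlonglongrightarrow> l"
proof (rule LIMSEQ_I)
  fix e :: real assume e: "0 < e"
  define V where "V n = (\<Sum>i<n. w i)" for n
  obtain K where K: "\<And>n. n \<ge> K \<Longrightarrow> \<bar>y n - l\<bar> < e / 2"
    using LIMSEQ_D[OF y, of "e/2"] e by auto
  define c where "c = (\<Sum>i<K. w i * \<bar>y i - l\<bar>)"
  have c0: "0 \<le> c" unfolding c_def by (intro sum_nonneg mult_nonneg_nonneg w) auto
  have "eventually (\<lambda>n. V n > 2 * c / e) sequentially" "eventually (\<lambda>n. V n > 0) sequentially"
    using W unfolding V_def filterlim_at_top_dense by auto
  then have "eventually (\<lambda>n. \<bar>(\<Sum>i<n. w i * y i) / V n - l\<bar> < e) sequentially"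
    using eventually_ge_at_top[of K]
  proof eventually_elim
    case (elim n)
    have "(\<Sum>i<n. w i * y i) / V n - l = (\<Sum>i<n. w i * (y i - l)) / V n"
      using elim(2) by (simp add: V_def field_simps sum_subtractf sum_distrib_left)
    also have "\<bar>\<dots>\<bar> \<le> (\<Sum>i<n. w i * \<bar>y i - l\<bar>) / V n"
      using elim(2) by (auto simp: abs_mult w intro!: divide_right_mono order.trans[OF sum_abs] sum_mono)
    finally have 1: "\<bar>(\<Sum>i<n. w i * y i) / V n - l\<bar> \<le> (\<Sum>i<n. w i * \<bar>y i - l\<bar>) / V n" .
    have split: "{..<n} = {..<K} \<union> {K..<n}" "{..<K} \<inter> {K..<n} = {}" using elim(3) by auto
    have "(\<Sum>i<n. w i * \<bar>y i - l\<bar>) = c + (\<Sum>i\<in>{K..<n}. w i * \<bar>y i - l\<bar>)"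
      unfolding c_def split(1) using split(2) by (subst sum.union_disjoint) auto
    also have "\<dots> \<le> c + (\<Sum>i\<in>{K..<n}. w i * (e/2))"
      by (intro add_left_mono sum_mono mult_left_mono w) (use K less_imp_le in auto)
    also have "(\<Sum>i\<in>{K..<n}. w i * (e/2)) = (e/2) * (\<Sum>i\<in>{K..<n}. w i)"
      by (simp add: sum_distrib_left mult.commute)
    also have "\<dots> \<le> (e/2) * V n"
      unfolding V_def by (intro mult_left_mono sum_mono2) (use e w in auto)
    also have "c < (e/2) * V n"
      using elim(1) e by (simp add: field_simps)
    finally have "(\<Sum>i<n. w i * \<bar>y i - l\<bar>) < e * V n" using e by simp
    then have "(\<Sum>i<n. w i * \<bar>y i - l\<bar>) / V n < e" using elim(2) by (simp add: field_simps)
    with 1 show ?case by linarith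
  qed
  then show "\<exists>no. \<forall>n\<ge>no. norm ((\<Sum>i<n. w i * y i) / (\<Sum>i<n. w i) - l) < e"
    by (simp add: eventually_sequentially V_def)
qed

text \<open>Kronecker's lemma, in the form used to divide a random sum by its natural scale.\<close>

lemma kronecker_lemma:
  fixes b x :: "nat \<Rightarrow> real"
  assumes inc: "\<And>n. b n \<le> b (Suc n)" and pos: "\<And>n. 0 < b n"
    and top: "filterlim b at_top sequentially" and sm: "summable (\<lambda>n. x n / b n)"
  shows "(\<lambda>n. (\<Sum>i<n. x i) / b n) \<longlonglongrightarrow> 0"
proof -
  define s where "s n = (\<Sum>i<n. x i / b i)" for n
  obtain l where l: "s \<longlonglongrightarrow> l"
    using sm unfolding s_def summable_iff_convergent convergent_def by blast
  define w where "w n = b (Suc n) - b n" for n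
  have W: "(\<Sum>i<n. w i) = b n - b 0" for n
    unfolding w_def by (rule sum_lessThan_telescope)
  have topW: "filterlim (\<lambda>n. \<Sum>i<n. w i) at_top sequentially"
    unfolding W using filterlim_tendsto_add_at_top[OF tendsto_const top, of "- b 0"] by simp
  \<comment> \<open>Summation by parts turns the claim into the weighted averages of the partial sums \<^term>\<open>s\<close>.\<close>
  have parts: "(\<Sum>i<n. x i) = b n * s n - (\<Sum>i<n. w i * s (Suc i))" for n
  proof (induction n)
    case (Suc n)
    have "s (Suc n) = s n + x n / b n" by (simp add: s_def)
    then show ?case using Suc pos[of n] by (simp add: w_def algebra_simps)
  qed (simp add: s_def)
  have c: "(\<lambda>n. (\<Sum>i<n. w i * s (Suc i)) / (\<Sum>i<n. w i)) \<longlonglongrightarrow> l"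
    by (rule weighted_cesaro[OF _ topW]) (use inc LIMSEQ_Suc[OF l] in \<open>auto simp: w_def\<close>)
  have "(\<lambda>n. b 0 / b n) \<longlonglongrightarrow> 0"
    by (rule tendsto_divide_0[OF tendsto_const]) (rule filterlim_at_top_imp_at_infinity[OF top])
  then have "(\<lambda>n. 1 - b 0 / b n) \<longlonglongrightarrow> 1 - 0" by (intro tendsto_intros)
  then have r: "(\<lambda>n. (\<Sum>i<n. w i) / b n) \<longlonglongrightarrow> 1"
    using pos by (simp add: W diff_divide_distrib less_imp_neq[symmetric])
  have "(\<lambda>n. s n - (\<Sum>i<n. w i * s (Suc i)) / (\<Sum>i<n. w i) * ((\<Sum>i<n. w i) / b n)) \<longlonglongrightarrow> l - l * 1"
    by (intro tendsto_diff tendsto_mult l c r)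
  moreover have "eventually (\<lambda>n. s n - (\<Sum>i<n. w i * s (Suc i)) / (\<Sum>i<n. w i) * ((\<Sum>i<n. w i) / b n)
     = (\<Sum>i<n. x i) / b n) sequentially"
    using topW[unfolded filterlim_at_top_dense, rule_format, of 0]
  proof eventually_elim
    case (elim n)
    then show ?case using pos[of n] by (simp add: parts field_simps)
  qed
  ultimately show ?thesis by (simp add: tendsto_cong)
qed

lemma abs_ln_one_plus_minus_le:
  fixes x :: real assumes "0 \<le> x" shows "\<bar>ln (1 + x) - x\<bar> \<le> x\<^sup>2"
proof -
  have "x - x\<^sup>2 \<le> ln (1 + x)"
  proof (cases "x \<le> 1")
    case True then show ?thesis using assms ln_one_plus_pos_lower_bound by simp
  next
    case False
    then have "x \<le> x\<^sup>2" by (simp add: power2_eq_square)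
    moreover have "0 \<le> ln (1 + x)" using assms by (intro ln_ge_zero) auto
    ultimately show ?thesis by linarith
  qed
  then show ?thesis using ln_add_one_self_le_self[OF assms] by auto
qed

section \<open>Almost sure convergence of random series\<close>

lemma integrable_mult_of_square_integrable:
  fixes f g :: "'a \<Rightarrow> real"
  assumes [measurable]: "f \<in> borel_measurable M" "g \<in> borel_measurable M"
    and "integrable M (\<lambda>x. (f x)\<^sup>2)" "integrable M (\<lambda>x. (g x)\<^sup>2)"
  shows "integrable M (\<lambda>x. f x * g x)"
proof (rule Bochner_Integration.integrable_bound[where f="\<lambda>x. (f x)\<^sup>2 + (g x)\<^sup>2"])
  have "\<bar>u * v\<bar> \<le> u\<^sup>2 + v\<^sup>2" for u v :: real
  proof -
    have "0 \<le> (\<bar>u\<bar> - \<bar>v\<bar>)\<^sup>2" by simp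
    then have "2 * (\<bar>u\<bar> * \<bar>v\<bar>) \<le> u\<^sup>2 + v\<^sup>2" by (simp add: power2_diff)
    moreover have "0 \<le> \<bar>u\<bar> * \<bar>v\<bar>" by simp
    ultimately show ?thesis unfolding abs_mult by linarith
  qed
  then show "AE x in M. norm (f x * g x) \<le> norm ((f x)\<^sup>2 + (g x)\<^sup>2)"
    by auto
qed (use assms in auto)

lemma integrable_mult_bounded:
  fixes f g :: "'a \<Rightarrow> real"
  assumes f: "integrable M f" and g: "g \<in> borel_measurable M" and b: "\<And>\<omega>. \<omega> \<in> space M \<Longrightarrow> \<bar>g \<omega>\<bar> \<le> b"
  shows "integrable M (\<lambda>\<omega>. f \<omega> * g \<omega>)"
proof (rule Bochner_Integration.integrable_bound[OF integrable_mult_left[OF f, of b]])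
  show "AE \<omega> in M. norm (f \<omega> * g \<omega>) \<le> norm (f \<omega> * b)"
  proof (rule AE_I2)
    fix \<omega> assume "\<omega> \<in> space M"
    then have "\<bar>g \<omega>\<bar> \<le> \<bar>b\<bar>" using b by fastforce
    then show "norm (f \<omega> * g \<omega>) \<le> norm (f \<omega> * b)" by (auto simp: abs_mult intro: mult_left_mono)
  qed
qed (use f g in auto)

lemma AE_summable_of_summable_integrals:
  fixes f :: "nat \<Rightarrow> 'a \<Rightarrow> real"
  assumes int: "\<And>n. integrable M (f n)" and nonneg: "\<And>n x. 0 \<le> f n x"
    and sum: "summable (\<lambda>n. \<integral>x. f n x \<partial>M)"
  shows "AE x in M. summable (\<lambda>n. f n x)"
proof -
  have [measurable]: "f n \<in> borel_measurable M" for n using int by auto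
  have "(\<integral>\<^sup>+x. (\<Sum>n. ennreal (f n x)) \<partial>M) = (\<Sum>n. \<integral>\<^sup>+x. ennreal (f n x) \<partial>M)"
    by (rule nn_integral_suminf) simp
  also have "\<dots> = (\<Sum>n. ennreal (\<integral>x. f n x \<partial>M))"
    using int nonneg by (subst nn_integral_eq_integral) auto
  also have "\<dots> = ennreal (\<Sum>n. \<integral>x. f n x \<partial>M)"
    using sum nonneg by (intro suminf_ennreal2) (auto intro: integral_nonneg_AE)
  finally have "(\<integral>\<^sup>+x. (\<Sum>n. ennreal (f n x)) \<partial>M) \<noteq> \<infinity>" by simp
  then have "AE x in M. (\<Sum>n. ennreal (f n x)) \<noteq> \<infinity>"
    by (intro nn_integral_PInf_AE) auto
  then show ?thesis
    by eventually_elim (use nonneg summable_suminf_not_top in auto)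
qed

lemma (in finite_measure) sigma_finite_subalgebraI: "subalgebra M Q \<Longrightarrow> sigma_finite_subalgebra M Q"
  by (rule finite_measure_subalgebra_is_sigma_finite)
     (simp add: finite_measure_subalgebra_def finite_measure_subalgebra_axioms_def finite_measure_axioms)

context prob_space
begin

text \<open>Kolmogorov's inequality for martingale differences. The hypothesis on conditional means is
  phrased as orthogonality: \<^term>\<open>\<xi> n\<close> integrates to zero against every square integrable
  function measurable with respect to \<^term>\<open>F n\<close>. This is what the independence and
  hypergeometric assumptions of the urn deliver directly. The proof bounds the second moment of
  the sum stopped when its absolute value first reaches \<^term>\<open>e\<close>.\<close>

lemma kolmogorov_maximal_inequality:
  fixes \<xi> :: "nat \<Rightarrow> 'a \<Rightarrow> real" and F :: "nat \<Rightarrow> 'a measure"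
  assumes sub: "\<And>n. subalgebra M (F n)"
    and mono: "\<And>i n. i \<le> n \<Longrightarrow> sets (F i) \<subseteq> sets (F n)"
    and adapted: "\<And>n. \<xi> n \<in> borel_measurable (F (Suc n))"
    and L2: "\<And>n. integrable M (\<lambda>\<omega>. (\<xi> n \<omega>)\<^sup>2)"
    and orth: "\<And>n f. f \<in> borel_measurable (F n) \<Longrightarrow> integrable M (\<lambda>\<omega>. (f \<omega>)\<^sup>2) \<Longrightarrow>
                 (\<integral>\<omega>. f \<omega> * \<xi> n \<omega> \<partial>M) = 0"
    and e: "0 < e"
  shows "prob {\<omega> \<in> space M. \<exists>k\<le>n. e \<le> \<bar>\<Sum>i<k. \<xi> i \<omega>\<bar>} \<le> (\<Sum>i<n. \<integral>\<omega>. (\<xi> i \<omega>)\<^sup>2 \<partial>M) / e\<^sup>2"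
proof -
  have sp: "space (F n) = space M" for n using sub by (simp add: subalgebra_def)
  have FM: "f \<in> borel_measurable (F n) \<Longrightarrow> f \<in> borel_measurable M" for f :: "'a \<Rightarrow> real" and n
    using measurable_from_subalg[OF sub] by blast
  have FF: "f \<in> borel_measurable (F i) \<Longrightarrow> i \<le> n \<Longrightarrow> f \<in> borel_measurable (F n)"
    for f :: "'a \<Rightarrow> real" and i n
    by (rule measurable_from_subalg) (auto simp: subalgebra_def sp mono)
  define S where "S n \<omega> = (\<Sum>i<n. \<xi> i \<omega>)" for n \<omega>
  have SF: "S k \<in> borel_measurable (F n)" if "k \<le> n" for k n
    unfolding S_def by (intro borel_measurable_sum FF[OF adapted]) (use that in auto)
  \<comment> \<open>\<^term>\<open>g n\<close> indicates that the level \<^term>\<open>e\<close> has not been reached up to time \<^term>\<open>n\<close>;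
    weighting the summands by these indicators gives the stopped sum.\<close>
  define g where "g n \<omega> = (if \<forall>k\<le>n. \<bar>S k \<omega>\<bar> < e then 1 else 0 :: real)" for n \<omega>
  have gF: "g n \<in> borel_measurable (F n)" for n
  proof -
    have [measurable]: "S k \<in> borel_measurable (F n)" if "k \<in> {..n}" for k
      using SF that by simp
    have "{\<omega> \<in> space (F n). \<forall>k\<in>{..n}. \<bar>S k \<omega>\<bar> < e} \<in> sets (F n)" by measurable
    then show ?thesis unfolding g_def by (intro measurable_If) (auto simp: Ball_def)
  qed
  define T where "T n \<omega> = (\<Sum>i<n. g i \<omega> * \<xi> i \<omega>)" for n \<omega>
  have TF: "T n \<in> borel_measurable (F n)" for n
    unfolding T_def by (intro borel_measurable_sum borel_measurable_times FF[OF adapted] FF[OF gF]) auto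
  note [measurable] = FM[OF TF] FM[OF gF] FM[OF adapted]
  have g01: "0 \<le> g n \<omega>" "g n \<omega> \<le> 1" "(g n \<omega>)\<^sup>2 = g n \<omega>" for n \<omega> by (auto simp: g_def)
  have T: "integrable M (\<lambda>\<omega>. (T n \<omega>)\<^sup>2) \<and> (\<integral>\<omega>. (T n \<omega>)\<^sup>2 \<partial>M) \<le> (\<Sum>i<n. \<integral>\<omega>. (\<xi> i \<omega>)\<^sup>2 \<partial>M)" for n
  proof (induction n)
    case (Suc n)
    then have I: "integrable M (\<lambda>\<omega>. (T n \<omega>)\<^sup>2)" by simp
    have Tg: "integrable M (\<lambda>\<omega>. (T n \<omega> * g n \<omega>)\<^sup>2)"
      by (rule Bochner_Integration.integrable_bound[OF I])
         (auto simp: power_mult_distrib g01 intro!: mult_left_le)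
    have gx: "integrable M (\<lambda>\<omega>. g n \<omega> * (\<xi> n \<omega>)\<^sup>2)"
      by (rule Bochner_Integration.integrable_bound[OF L2[of n]])
         (auto simp: abs_mult g01 intro!: mult_left_le_one_le)
    have c: "integrable M (\<lambda>\<omega>. (T n \<omega> * g n \<omega>) * \<xi> n \<omega>)"
      by (rule integrable_mult_of_square_integrable[OF _ _ Tg L2]) auto
    have eq: "(T (Suc n) \<omega>)\<^sup>2 = (T n \<omega>)\<^sup>2 + 2 * ((T n \<omega> * g n \<omega>) * \<xi> n \<omega>) + g n \<omega> * (\<xi> n \<omega>)\<^sup>2" for \<omega>
      using g01(3)[of n \<omega>] by (simp add: T_def power2_sum power_mult_distrib)
    have o: "(\<integral>\<omega>. (T n \<omega> * g n \<omega>) * \<xi> n \<omega> \<partial>M) = 0"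
      by (rule orth[OF _ Tg]) (use TF gF in simp)
    have "(\<integral>\<omega>. g n \<omega> * (\<xi> n \<omega>)\<^sup>2 \<partial>M) \<le> (\<integral>\<omega>. (\<xi> n \<omega>)\<^sup>2 \<partial>M)"
      by (rule integral_mono[OF gx L2]) (simp add: g01 mult_left_le_one_le)
    then show ?case unfolding eq using I c gx o Suc by auto
  qed (simp add: T_def)
  have stop: "if \<exists>k\<le>n. e \<le> \<bar>S k \<omega>\<bar> then e \<le> \<bar>T n \<omega>\<bar> else T n \<omega> = S n \<omega>" for n \<omega>
  proof (induction n)
    case (Suc n)
    show ?case
    proof (cases "\<exists>k\<le>n. e \<le> \<bar>S k \<omega>\<bar>")
      case True
      then have "g n \<omega> = 0" by (auto simp: g_def not_less)
      then show ?thesis using True Suc by (auto simp: T_def intro: le_SucI)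
    next
      case False
      then have "g n \<omega> = 1" by (auto simp: g_def not_le)
      moreover have "T n \<omega> = S n \<omega>" using Suc unfolding if_not_P[OF False] .
      ultimately have "T (Suc n) \<omega> = S (Suc n) \<omega>" by (simp add: T_def S_def)
      then show ?thesis using False by (auto simp: le_Suc_eq)
    qed
  qed (use e in \<open>auto simp: T_def S_def\<close>)
  have "prob {\<omega> \<in> space M. \<exists>k\<le>n. e \<le> \<bar>S k \<omega>\<bar>} \<le> prob {\<omega> \<in> space M. e\<^sup>2 \<le> (T n \<omega>)\<^sup>2}"
  proof (rule finite_measure_mono)
    show "{\<omega> \<in> space M. \<exists>k\<le>n. e \<le> \<bar>S k \<omega>\<bar>} \<subseteq> {\<omega> \<in> space M. e\<^sup>2 \<le> (T n \<omega>)\<^sup>2}"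
    proof safe
      fix \<omega> k assume "k \<le> n" "e \<le> \<bar>S k \<omega>\<bar>"
      then have "e \<le> \<bar>T n \<omega>\<bar>" using stop[of n \<omega>] by (auto split: if_splits)
      then show "e\<^sup>2 \<le> (T n \<omega>)\<^sup>2" using e abs_le_square_iff[of e "T n \<omega>"] by simp
    qed
  qed measurable
  also have "\<dots> \<le> (\<integral>\<omega>. (T n \<omega>)\<^sup>2 \<partial>M) / e\<^sup>2"
    by (rule integral_Markov_inequality_measure[where A="space M"]) (use T e in auto)
  also have "\<dots> \<le> (\<Sum>i<n. \<integral>\<omega>. (\<xi> i \<omega>)\<^sup>2 \<partial>M) / e\<^sup>2"
    using T[of n] by (intro divide_right_mono) auto
  finally show ?thesis unfolding S_def .
qed

text \<open>Convergence of martingales that are bounded in mean square, stated for the differences.\<close>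

theorem martingale_differences_summable:
  fixes \<xi> :: "nat \<Rightarrow> 'a \<Rightarrow> real" and F :: "nat \<Rightarrow> 'a measure"
  assumes sub: "\<And>n. subalgebra M (F n)"
    and mono: "\<And>i n. i \<le> n \<Longrightarrow> sets (F i) \<subseteq> sets (F n)"
    and adapted: "\<And>n. \<xi> n \<in> borel_measurable (F (Suc n))"
    and L2: "\<And>n. integrable M (\<lambda>\<omega>. (\<xi> n \<omega>)\<^sup>2)"
    and orth: "\<And>n f. f \<in> borel_measurable (F n) \<Longrightarrow> integrable M (\<lambda>\<omega>. (f \<omega>)\<^sup>2) \<Longrightarrow>
                 (\<integral>\<omega>. f \<omega> * \<xi> n \<omega> \<partial>M) = 0"
    and var: "summable (\<lambda>n. \<integral>\<omega>. (\<xi> n \<omega>)\<^sup>2 \<partial>M)"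
  shows "AE \<omega> in M. summable (\<lambda>n. \<xi> n \<omega>)"
proof -
  define v where "v n = (\<integral>\<omega>. (\<xi> n \<omega>)\<^sup>2 \<partial>M)" for n
  have v0: "0 \<le> v n" for n by (simp add: v_def)
  have sv: "summable v" using var by (simp add: v_def[abs_def])
  have [measurable]: "\<xi> n \<in> borel_measurable M" for n
    using measurable_from_subalg[OF sub adapted] .
  \<comment> \<open>An outcome lies in \<^term>\<open>B e l\<close> if some partial sum started at index \<^term>\<open>l\<close> reaches \<^term>\<open>e\<close> in absolute value.\<close>
  define B where "B e l = {\<omega> \<in> space M. \<exists>k. e \<le> \<bar>\<Sum>i<k. \<xi> (i + l) \<omega>\<bar>}" for e l
  have BM: "B e l \<in> sets M" for e l unfolding B_def by measurable
  have Ble: "prob (B e l) \<le> (\<Sum>i. v (i + l)) / e\<^sup>2" if e: "0 < e" for e l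
  proof -
    define C where "C n = {\<omega> \<in> space M. \<exists>k\<le>n. e \<le> \<bar>\<Sum>i<k. \<xi> (i + l) \<omega>\<bar>}" for n
    have CM: "C n \<in> sets M" for n unfolding C_def by measurable
    have "prob (C n) \<le> (\<Sum>i. v (i + l)) / e\<^sup>2" for n
    proof -
      have "prob (C n) \<le> (\<Sum>i<n. \<integral>\<omega>. (\<xi> (i + l) \<omega>)\<^sup>2 \<partial>M) / e\<^sup>2"
        unfolding C_def
      proof (rule kolmogorov_maximal_inequality[where F="\<lambda>n. F (n + l)"])
        show "\<xi> (i + l) \<in> borel_measurable (F (Suc i + l))" for i
          using adapted[of "i + l"] by simp
        show "sets (F (i + l)) \<subseteq> sets (F (n + l))" if "i \<le> n" for i n
          using mono that by simp
        show "(\<integral>\<omega>. f \<omega> * \<xi> (i + l) \<omega> \<partial>M) = 0"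
          if "f \<in> borel_measurable (F (i + l))" "integrable M (\<lambda>\<omega>. (f \<omega>)\<^sup>2)" for i f
          by (rule orth[OF that])
      qed (rule sub L2 e)+
      also have "\<dots> \<le> (\<Sum>i. v (i + l)) / e\<^sup>2"
        unfolding v_def[symmetric]
        by (intro divide_right_mono sum_le_suminf summable_ignore_initial_segment sv) (auto simp: v0)
      finally show ?thesis .
    qed
    moreover have "(\<lambda>n. prob (C n)) \<longlonglongrightarrow> prob (\<Union>n. C n)"
      by (rule finite_Lim_measure_incseq)
         (use CM in \<open>auto simp: incseq_def C_def intro: order.trans\<close>)
    moreover have "(\<Union>n. C n) = B e l" by (auto simp: C_def B_def)
    ultimately show ?thesis by (auto intro: LIMSEQ_le_const2)
  qed
  have tail: "(\<lambda>l. \<Sum>i. v (i + l)) \<longlonglongrightarrow> 0"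
    using suminf_exist_split2[OF sv] by simp
  have null: "AE \<omega> in M. \<exists>l. \<omega> \<notin> B e l" if e: "0 < e" for e
  proof -
    have I: "(\<Inter>l. B e l) \<in> sets M" using BM by auto
    have "prob (\<Inter>l. B e l) \<le> (\<Sum>i. v (i + l)) / e\<^sup>2" for l
      by (rule order.trans[OF finite_measure_mono Ble[OF e]]) (use BM in auto)
    moreover have "(\<lambda>l. (\<Sum>i. v (i + l)) / e\<^sup>2) \<longlonglongrightarrow> 0"
      using tendsto_divide[OF tail tendsto_const[of "e\<^sup>2"]] e by simp
    ultimately have "prob (\<Inter>l. B e l) \<le> 0" by (intro LIMSEQ_le_const) auto
    then have "prob (\<Inter>l. B e l) = 0" using measure_nonneg[of M "\<Inter>l. B e l"] by linarith
    then have "emeasure M (\<Inter>l. B e l) = 0" by (simp add: emeasure_eq_measure)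
    then have "AE \<omega> in M. \<omega> \<notin> (\<Inter>l. B e l)" using I by (intro AE_not_in null_setsI)
    then show ?thesis by auto
  qed
  have "AE \<omega> in M. \<forall>j. \<exists>l. \<omega> \<notin> B (1 / real (Suc j)) l"
    unfolding AE_all_countable by (intro allI null) simp
  then show ?thesis
    using AE_space
  proof eventually_elim
    case (elim \<omega>)
    have "Cauchy (\<lambda>n. \<Sum>i<n. \<xi> i \<omega>)"
    proof (rule metric_CauchyI)
      fix e :: real assume "0 < e"
      then obtain j where j: "1 / real (Suc j) < e / 2"
        using reals_Archimedean[of "e/2"] by (auto simp: inverse_eq_divide)
      obtain l where l: "\<omega> \<notin> B (1 / real (Suc j)) l" using elim by blast
      have d: "\<bar>(\<Sum>i<n. \<xi> i \<omega>) - (\<Sum>i<l. \<xi> i \<omega>)\<bar> < e / 2" if "n \<ge> l" for n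
      proof -
        have "(\<Sum>i<n. \<xi> i \<omega>) - (\<Sum>i<l. \<xi> i \<omega>) = (\<Sum>i\<in>{l..<n}. \<xi> i \<omega>)"
          using sum_diff_nat_ivl[of 0 l n "\<lambda>i. \<xi> i \<omega>"] that by (simp add: atLeast0LessThan)
        also have "\<dots> = (\<Sum>i<n - l. \<xi> (i + l) \<omega>)"
          using sum.shift_bounds_nat_ivl[of "\<lambda>i. \<xi> i \<omega>" 0 l "n - l"] that
          by (simp add: atLeast0LessThan)
        also have "\<bar>\<dots>\<bar> < 1 / real (Suc j)" using l elim by (auto simp: B_def not_le)
        finally show ?thesis using j by linarith
      qed
      show "\<exists>K. \<forall>m\<ge>K. \<forall>n\<ge>K. dist (\<Sum>i<m. \<xi> i \<omega>) (\<Sum>i<n. \<xi> i \<omega>) < e"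
      proof (intro exI allI impI)
        fix m n assume "m \<ge> l" "n \<ge> l"
        then show "dist (\<Sum>i<m. \<xi> i \<omega>) (\<Sum>i<n. \<xi> i \<omega>) < e"
          using d[of m] d[of n] unfolding dist_real_def by linarith
      qed
    qed
    then show ?case by (simp add: summable_iff_convergent Cauchy_convergent_iff)
  qed
qed

end

section \<open>The mean of the multivariate hypergeometric distribution\<close>

text \<open>A coefficient of a product of polynomials, as a sum over exponent vectors. The box bound
  \<^term>\<open>B\<close> may exceed the degree \<^term>\<open>N\<close>, so that one index set serves for all values
  of \<^term>\<open>N\<close> up to \<^term>\<open>B\<close>.\<close>

lemma coeff_prod_PiE:
  fixes P :: "'i \<Rightarrow> real poly"
  assumes "finite I" "N \<le> B"
  shows "coeff (\<Prod>i\<in>I. P i) N =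
    (\<Sum>x\<in>PiE I (\<lambda>_. {..B}). if (\<Sum>i\<in>I. x i) = N then \<Prod>i\<in>I. coeff (P i) (x i) else 0)"
  using assms
proof (induction I arbitrary: N rule: finite_induct)
  case (insert a I)
  let ?E = "PiE I (\<lambda>_. {..B})"
  have "(\<Sum>x\<in>PiE (insert a I) (\<lambda>_. {..B}).
      if (\<Sum>i\<in>insert a I. x i) = N then \<Prod>i\<in>insert a I. coeff (P i) (x i) else 0)
    = (\<Sum>(y, g)\<in>{..B} \<times> ?E. if (\<Sum>i\<in>insert a I. (g(a := y)) i) = N
        then \<Prod>i\<in>insert a I. coeff (P i) ((g(a := y)) i) else 0)"
    unfolding PiE_insert_eq
    by (subst sum.reindex[OF inj_combinator[OF insert.hyps(2)]]) (simp add: case_prod_unfold)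
  also have "\<dots> = (\<Sum>(y, g)\<in>{..B} \<times> ?E. if y + (\<Sum>i\<in>I. g i) = N
        then coeff (P a) y * (\<Prod>i\<in>I. coeff (P i) (g i)) else 0)"
  proof (intro sum.cong refl, clarify)
    fix y g
    have "(\<Sum>i\<in>I. (g(a := y)) i) = (\<Sum>i\<in>I. g i)"
      "(\<Prod>i\<in>I. coeff (P i) ((g(a := y)) i)) = (\<Prod>i\<in>I. coeff (P i) (g i))"
      using insert.hyps(2) by (auto intro!: sum.cong prod.cong)
    then show "(if (\<Sum>i\<in>insert a I. (g(a := y)) i) = N
        then \<Prod>i\<in>insert a I. coeff (P i) ((g(a := y)) i) else 0) =
      (if y + (\<Sum>i\<in>I. g i) = N then coeff (P a) y * (\<Prod>i\<in>I. coeff (P i) (g i)) else 0)"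
      using insert.hyps by simp
  qed
  also have "\<dots> = (\<Sum>y\<le>B. \<Sum>g\<in>?E. if y + (\<Sum>i\<in>I. g i) = N
        then coeff (P a) y * (\<Prod>i\<in>I. coeff (P i) (g i)) else 0)"
    by (simp add: sum.cartesian_product)
  also have "\<dots> = (\<Sum>y\<le>N. \<Sum>g\<in>?E. if y + (\<Sum>i\<in>I. g i) = N
        then coeff (P a) y * (\<Prod>i\<in>I. coeff (P i) (g i)) else 0)"
    by (rule sum.mono_neutral_right) (use insert.prems in \<open>auto intro!: sum.neutral\<close>)
  also have "\<dots> = (\<Sum>y\<le>N. coeff (P a) y * coeff (\<Prod>i\<in>I. P i) (N - y))"
  proof (intro sum.cong refl)
    fix y assume "y \<in> {..N}"
    then have y: "y \<le> N" by simp
    then have *: "y + s = N \<longleftrightarrow> s = N - y" for s by auto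
    have "N - y \<le> B" using insert.prems by simp
    from insert.IH[OF this] show "(\<Sum>g\<in>?E. if y + (\<Sum>i\<in>I. g i) = N
        then coeff (P a) y * (\<Prod>i\<in>I. coeff (P i) (g i)) else 0)
      = coeff (P a) y * coeff (\<Prod>i\<in>I. P i) (N - y)"
      unfolding * by (simp add: sum_distrib_left if_distrib cong: if_cong)
  qed
  also have "\<dots> = coeff (\<Prod>i\<in>insert a I. P i) N"
    using insert.hyps by (simp add: coeff_mult)
  finally show ?case by simp
qed simp

lemma coeff_one_plus_X_power: "coeff ([:1, 1:] ^ n) k = real (n choose k)"
proof (cases "k \<le> n")
  case True
  then show ?thesis by (simp add: coeff_linear_poly_power)
next
  case False
  then have "degree ([:1, 1:] ^ n :: real poly) < k" by (simp add: degree_power_eq)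
  then show ?thesis using False by (simp add: coeff_eq_0)
qed

text \<open>The mean of a multivariate hypergeometric count. Weighting the binomial coefficients of colour
  \<^term>\<open>k\<close> by the count replaces the generating polynomial $(1+z)^{h_k}$ by
  $h_k z (1+z)^{h_k-1}$; the sum is then a coefficient of $h_k z (1+z)^{s-1}$, where $s$ is the
  total number of balls.\<close>

lemma mv_hypergeometric_mean:
  assumes k: "k \<in> {1..d}" and N: "1 \<le> N" "N \<le> B" "N \<le> (\<Sum>i=1..d. h i)" and hk: "0 < h k"
  shows "(\<Sum>x\<in>PiE {1..d} (\<lambda>_. {..B}). real (x k) * mv_hypergeometric d h N x)
    = real N * real (h k) / real (\<Sum>i=1..d. h i)"
proof -
  define s where "s = (\<Sum>i=1..d. h i)"
  define P :: "nat \<Rightarrow> real poly" where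
    "P i = (if i = k then smult (real (h k)) (monom 1 1 * [:1, 1:] ^ (h k - 1)) else [:1, 1:] ^ h i)" for i
  have cP: "coeff (P i) j = (if i = k then real j else 1) * real (h i choose j)" for i j
  proof (cases "i = k")
    case True
    show ?thesis
    proof (cases j)
      case 0
      then show ?thesis using True by (simp add: P_def coeff_monom_mult)
    next
      case (Suc l)
      have "Suc l * (h k choose Suc l) = h k * (h k - 1 choose l)"
        using Suc_times_binomial[of l "h k - 1"] hk by simp
      then have "real (h k) * real (h k - 1 choose l) = real (Suc l) * real (h k choose Suc l)"
        by (metis of_nat_mult)
      then show ?thesis using True Suc
        by (simp add: P_def coeff_monom_mult coeff_one_plus_X_power)
    qed
  qed (simp add: P_def coeff_one_plus_X_power)
  have sk: "s = h k + (\<Sum>i\<in>{1..d}-{k}. h i)" unfolding s_def using k by (simp add: sum.remove)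
  have "(\<Prod>i\<in>{1..d}. P i) = P k * (\<Prod>i\<in>{1..d}-{k}. P i)" using k by (simp add: prod.remove)
  also have "(\<Prod>i\<in>{1..d}-{k}. P i) = [:1,1:] ^ (\<Sum>i\<in>{1..d}-{k}. h i)"
    unfolding power_sum by (intro prod.cong) (auto simp: P_def)
  also have "P k * \<dots> = smult (real (h k)) (monom 1 1 * [:1, 1:] ^ (s - 1))"
    using hk by (simp add: P_def sk mult.assoc power_add[symmetric])
  finally have "coeff (\<Prod>i\<in>{1..d}. P i) N = real (h k) * real (s - 1 choose (N - 1))"
    using N by (simp add: coeff_monom_mult coeff_one_plus_X_power)
  also have "\<dots> = real N * real (h k) / real s * real (s choose N)"
  proof -
    have "0 < s" using sk hk by simp
    moreover have "N * (s choose N) = s * (s - 1 choose (N - 1))"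
      using Suc_times_binomial[of "N - 1" "s - 1"] N \<open>0 < s\<close> by simp
    then have "real s * real (s - 1 choose (N - 1)) = real N * real (s choose N)"
      by (metis of_nat_mult)
    ultimately show ?thesis by (simp add: field_simps)
  qed
  finally have c: "coeff (\<Prod>i\<in>{1..d}. P i) N = real N * real (h k) / real s * real (s choose N)" .
  have "(\<Sum>x\<in>PiE {1..d} (\<lambda>_. {..B}). real (x k) * mv_hypergeometric d h N x)
    = (\<Sum>x\<in>PiE {1..d} (\<lambda>_. {..B}).
        (if (\<Sum>i\<in>{1..d}. x i) = N then \<Prod>i\<in>{1..d}. coeff (P i) (x i) else 0) / real (s choose N))"
  proof (intro sum.cong refl)
    fix x
    have 1: "(\<Prod>i\<in>{1..d}. coeff (P i) (x i)) = real (x k) * (\<Prod>i\<in>{1..d}. real (h i choose x i))"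
      unfolding cP prod.distrib using k by (simp add: prod.delta)
    have 2: "(\<Prod>i\<in>{1..d}. real (h i choose x i)) = 0" if "\<not> (\<forall>i\<in>{1..d}. x i \<le> h i)"
      using that by (auto simp: not_le intro!: prod_zero binomial_eq_0)
    show "real (x k) * mv_hypergeometric d h N x
      = (if (\<Sum>i\<in>{1..d}. x i) = N then \<Prod>i\<in>{1..d}. coeff (P i) (x i) else 0) / real (s choose N)"
      unfolding 1 mv_hypergeometric_def s_def using 2 by auto
  qed
  also have "\<dots> = coeff (\<Prod>i\<in>{1..d}. P i) N / real (s choose N)"
    using coeff_prod_PiE[of "{1..d}" N B P] N(2) by (simp add: sum_divide_distrib)
  also have "\<dots> = real N * real (h k) / real s"
  proof -
    have "0 < (s choose N)" using N(3) by (simp add: s_def)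
    then show ?thesis unfolding c by simp
  qed
  finally show ?thesis unfolding s_def .
qed

section \<open>Asymptotics of a single path\<close>

lemma frac_cancel: "u \<noteq> 0 \<Longrightarrow> u / v * (w / u) = w / v" for u v w :: real
  by simp

lemma powr_limit_eq:
  fixes c w p y :: real
  assumes "0 < c" "0 < w"
  shows "(c * w) powr p * y / c = y * w powr p / c powr (1 - p)"
  using assms by (simp add: powr_mult powr_diff)

text \<open>One realisation of the urn, as real sequences. The index \<^term>\<open>n\<close> of \<^term>\<open>a\<close>,
  \<^term>\<open>x\<close>, \<^term>\<open>mu\<close> and \<^term>\<open>D\<close> counts completed stages, so these sequences describe stage
  \<^term>\<open>n + 1\<close>: \<^term>\<open>a n k\<close> is the replacement factor, \<^term>\<open>mu n k\<close> its mean, \<^term>\<open>x n k\<close> the number of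
  balls of colour \<^term>\<open>k\<close> drawn, \<^term>\<open>D n\<close> the number of all balls drawn, and \<^term>\<open>c n\<close> the
  conditional mean of \<^term>\<open>D n\<close>; \<^term>\<open>K\<close> bounds the sequence \<^term>\<open>D\<close>. The last four
  assumptions are the facts that hold almost surely by martingale convergence and moment bounds;
  everything below is deterministic.\<close>

locale urn_path =
  fixes d :: nat and h0 :: "nat \<Rightarrow> real" and a x mu :: "nat \<Rightarrow> nat \<Rightarrow> real" and D c :: "nat \<Rightarrow> real"
    and m :: "nat \<Rightarrow> real" and N K :: real
  assumes h0_pos: "\<And>k. k \<in> {1..d} \<Longrightarrow> 0 < h0 k"
    and x_nonneg: "\<And>n k. k \<in> {1..d} \<Longrightarrow> 0 \<le> x n k"
    and a_ge_1: "\<And>n k. k \<in> {1..d} \<Longrightarrow> 1 \<le> a n k"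
    and D_sum: "\<And>n. (\<Sum>k=1..d. x n k) = D n"
    and D_ge_1: "\<And>n. 1 \<le> D n" and D_le: "\<And>n. D n \<le> K"
    and N_pos: "0 < N"
    and mu_ge_1: "\<And>n k. k \<in> {1..d} \<Longrightarrow> 1 \<le> mu n k"
    and mu_lim: "\<And>k. k \<in> {1..d} \<Longrightarrow> (\<lambda>n. mu n k) \<longlonglongrightarrow> m k"
    and mu_prop: "\<And>k j. k \<in> {1..d} \<Longrightarrow> j \<in> {1..d} \<Longrightarrow>
      summable (\<lambda>n. \<bar>mu (Suc n) k * m j - m k * mu (Suc n) j\<bar> / real (Suc n))"
    and c_lim: "c \<longlonglongrightarrow> N"
    and sum_a: "\<And>k. k \<in> {1..d} \<Longrightarrow>
      summable (\<lambda>n. (a n k - mu n k) * x n k / (h0 k + (\<Sum>i<n. a i k * x i k)))"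
    and sum_x: "\<And>k. k \<in> {1..d} \<Longrightarrow>
      summable (\<lambda>n. mu n k * (x n k / (h0 k + (\<Sum>i<n. a i k * x i k))
                              - D n / (\<Sum>j=1..d. h0 j + (\<Sum>i<n. a i j * x i j))))"
    and sum_sq: "\<And>k. k \<in> {1..d} \<Longrightarrow>
      summable (\<lambda>n. (a n k * x n k / (h0 k + (\<Sum>i<n. a i k * x i k)))\<^sup>2)"
    and sum_D: "summable (\<lambda>n. (D n - c n) / real (Suc n))"
begin

text \<open>The number of balls of colour \<^term>\<open>k\<close>, and of all balls, after \<^term>\<open>n\<close> stages.\<close>

definition h :: "nat \<Rightarrow> nat \<Rightarrow> real" where "h n k = h0 k + (\<Sum>i<n. a i k * x i k)"
definition s :: "nat \<Rightarrow> real" where "s n = (\<Sum>k=1..d. h n k)"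

lemma ax_nonneg: "k \<in> {1..d} \<Longrightarrow> 0 \<le> a n k * x n k"
  using a_ge_1[of k n] x_nonneg[of k n] by simp

lemma h_Suc: "h (Suc n) k = h n k + a n k * x n k"
  by (simp add: h_def)

lemma h_pos: "k \<in> {1..d} \<Longrightarrow> 0 < h n k"
  unfolding h_def using h0_pos by (intro add_pos_nonneg sum_nonneg ax_nonneg) auto

lemma h_mono: "k \<in> {1..d} \<Longrightarrow> h n k \<le> h (Suc n) k"
  using ax_nonneg by (simp add: h_Suc)

lemma s_ge: "real n \<le> s n"
proof (induction n)
  case 0
  have "0 \<le> s 0" unfolding s_def by (intro sum_nonneg less_imp_le[OF h_pos])
  then show ?case by simp
next
  case (Suc n)
  have "s n + D n = (\<Sum>k=1..d. h n k + x n k)"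
    by (simp add: s_def sum.distrib D_sum[symmetric])
  also have "\<dots> \<le> s (Suc n)"
    unfolding s_def h_Suc
  proof (intro sum_mono add_left_mono)
    fix k assume "k \<in> {1..d}"
    then show "x n k \<le> a n k * x n k"
      using mult_right_mono[OF a_ge_1[of k n] x_nonneg[of k n]] by simp
  qed
  finally show ?case using Suc D_ge_1[of n] by simp
qed

lemma d_pos: "1 \<in> {1..d}"
proof (rule ccontr)
  assume "1 \<notin> {1..d}"
  then have "D 0 = 0" by (simp add: D_sum[symmetric] not_le)
  then show False using D_ge_1[of 0] by simp
qed

lemma s_pos: "0 < s n"
  unfolding s_def using h_pos d_pos by (intro sum_pos) auto

lemma m_ge_1: "k \<in> {1..d} \<Longrightarrow> 1 \<le> m k"
  by (rule LIMSEQ_le_const[OF mu_lim]) (use mu_ge_1 in auto)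

text \<open>The logarithm of a colour count is, up to a convergent error, the sum of its conditional
  expected relative increments: \<^term>\<open>mu i k * D i / s i\<close> is the mean of
  \<^term>\<open>a i k * x i k / h i k\<close> given the past and the number of balls drawn. The three
  convergent parts of the error are the second-order error of the logarithm and the fluctuations of the replacement factors and of the draws.\<close>

lemma ln_h_minus_compensator_convergent:
  assumes k: "k \<in> {1..d}"
  shows "convergent (\<lambda>n. ln (h n k) - (\<Sum>i<n. mu i k * D i / s i))"
proof -
  define r where "r i = a i k * x i k / h i k" for i
  have r0: "0 \<le> r i" for i unfolding r_def using ax_nonneg[OF k] h_pos[OF k, of i] by simp
  have sq: "summable (\<lambda>i. (r i)\<^sup>2)" using sum_sq[OF k] unfolding r_def h_def .
  have 1: "summable (\<lambda>i. ln (1 + r i) - r i)"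
    by (rule summable_comparison_test'[OF sq, of 0]) (use abs_ln_one_plus_minus_le r0 in simp)
  have 2: "summable (\<lambda>i. (a i k - mu i k) * x i k / h i k)" using sum_a[OF k] unfolding h_def .
  have 3: "summable (\<lambda>i. mu i k * (x i k / h i k - D i / s i))"
    using sum_x[OF k] unfolding h_def s_def .
  have inc: "ln (h (Suc i) k) - ln (h i k) - mu i k * D i / s i
     = (ln (1 + r i) - r i) + (a i k - mu i k) * x i k / h i k + mu i k * (x i k / h i k - D i / s i)" for i
  proof -
    have hi: "0 < h i k" using h_pos[OF k] .
    have "h (Suc i) k = h i k * (1 + r i)" using hi by (simp add: h_Suc r_def field_simps)
    then have "ln (h (Suc i) k) - ln (h i k) = ln (1 + r i)"
      using hi r0[of i] by (simp add: ln_mult)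
    then show ?thesis using hi s_pos[of i] by (simp add: r_def field_simps)
  qed
  have "ln (h n k) - (\<Sum>i<n. mu i k * D i / s i) = ln (h 0 k)
     + (\<Sum>i<n. (ln (1 + r i) - r i) + (a i k - mu i k) * x i k / h i k + mu i k * (x i k / h i k - D i / s i))" for n
  proof (induction n)
    case (Suc n)
    show ?case using Suc inc[of n] by simp
  qed simp
  moreover have "convergent (\<lambda>n. ln (h 0 k)
     + (\<Sum>i<n. (ln (1 + r i) - r i) + (a i k - mu i k) * x i k / h i k + mu i k * (x i k / h i k - D i / s i)))"
    using summable_add[OF summable_add[OF 1 2] 3]
    by (intro convergent_add convergent_const) (simp add: summable_iff_convergent)
  ultimately show ?thesis by simp
qed

text \<open>After division by the limiting means the compensators of two colours differ by a convergent
  series, because the total number of balls after \<^term>\<open>n\<close> stages is at least \<^term>\<open>n\<close>.\<close>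

lemma ln_h_diff_convergent:
  assumes k: "k \<in> {1..d}" and j: "j \<in> {1..d}"
  shows "convergent (\<lambda>n. ln (h n j) / m j - ln (h n k) / m k)"
proof -
  have mj: "0 < m j" and mk: "0 < m k" using m_ge_1[OF j] m_ge_1[OF k] by auto
  define u where "u i = (mu i j / m j - mu i k / m k) * D i / s i" for i
  have "summable (\<lambda>n. u (Suc n))"
  proof (rule summable_comparison_test'[of _ 0])
    show "summable (\<lambda>n. K / (m j * m k) * (\<bar>mu (Suc n) j * m k - m j * mu (Suc n) k\<bar> / real (Suc n)))"
      by (intro summable_mult mu_prop j k)
    fix n :: nat
    have "\<bar>u (Suc n)\<bar> = \<bar>mu (Suc n) j * m k - m j * mu (Suc n) k\<bar> / (m j * m k) * (D (Suc n) / s (Suc n))"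
      using mj mk s_pos[of "Suc n"] D_ge_1[of "Suc n"]
      by (simp add: u_def abs_mult abs_divide diff_frac_eq mult.commute)
    also have "\<dots> \<le> \<bar>mu (Suc n) j * m k - m j * mu (Suc n) k\<bar> / (m j * m k) * (K / real (Suc n))"
    proof (intro mult_left_mono frac_le)
      show "D (Suc n) \<le> K" "0 \<le> K" using D_le[of "Suc n"] D_ge_1[of "Suc n"] by auto
      show "real (Suc n) \<le> s (Suc n)" by (rule s_ge)
    qed (use mj mk in auto)
    finally show "norm (u (Suc n)) \<le> K / (m j * m k) * (\<bar>mu (Suc n) j * m k - m j * mu (Suc n) k\<bar> / real (Suc n))"
      by (simp add: mult.commute)
  qed
  then have U: "convergent (\<lambda>n. \<Sum>i<n. u i)" by (simp add: summable_Suc_iff summable_iff_convergent)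
  let ?L = "\<lambda>k n. ln (h n k) - (\<Sum>i<n. mu i k * D i / s i)"
  have "ln (h n j) / m j - ln (h n k) / m k = ?L j n * (1 / m j) - ?L k n * (1 / m k) + (\<Sum>i<n. u i)" for n
  proof -
    have "(\<Sum>i<n. u i) = (\<Sum>i<n. mu i j * D i / s i) / m j - (\<Sum>i<n. mu i k * D i / s i) / m k"
      unfolding sum_divide_distrib sum_subtractf[symmetric] u_def
      by (intro sum.cong refl) (simp add: algebra_simps diff_divide_distrib)
    then show ?thesis by (simp add: diff_divide_distrib)
  qed
  moreover have "convergent (\<lambda>n. ?L j n * (1 / m j) - ?L k n * (1 / m k) + (\<Sum>i<n. u i))"
    by (intro convergent_add convergent_diff convergent_mult convergent_const U
        ln_h_minus_compensator_convergent j k)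
  ultimately show ?thesis by simp
qed

lemma h_ratio_limit:
  assumes k: "k \<in> {1..d}" and j: "j \<in> {1..d}"
  shows "\<exists>l>0. (\<lambda>n. h n j / h n k powr (m j / m k)) \<longlonglongrightarrow> l"
proof -
  have mj: "0 < m j" and mk: "0 < m k" using m_ge_1[OF j] m_ge_1[OF k] by auto
  obtain l where l: "(\<lambda>n. ln (h n j) / m j - ln (h n k) / m k) \<longlonglongrightarrow> l"
    using ln_h_diff_convergent[OF k j] by (auto simp: convergent_def)
  have "h n j / h n k powr (m j / m k) = exp (m j * (ln (h n j) / m j - ln (h n k) / m k))" for n
    using h_pos[OF k, of n] h_pos[OF j, of n] mj
    by (simp add: powr_def right_diff_distrib exp_diff)
  moreover have "(\<lambda>n. exp (m j * (ln (h n j) / m j - ln (h n k) / m k))) \<longlonglongrightarrow> exp (m j * l)"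
    by (intro tendsto_intros l)
  ultimately show ?thesis by (intro exI[of _ "exp (m j * l)"]) simp
qed

text \<open>A bounded colour count would force all the others, and with them the total, to be bounded.\<close>

lemma h_at_top:
  assumes k: "k \<in> {1..d}"
  shows "filterlim (\<lambda>n. h n k) at_top sequentially"
proof (rule ccontr)
  assume not_top: "\<not> ?thesis"
  have "incseq (\<lambda>n. h n k)" using h_mono[OF k] by (rule incseq_SucI)
  have "\<exists>C. \<forall>n. h n k \<le> C"
  proof (rule ccontr)
    assume "\<not> (\<exists>C. \<forall>n. h n k \<le> C)"
    then have "\<exists>n0. C \<le> h n0 k" for C by (meson linear)
    then have "\<exists>n0. \<forall>n\<ge>n0. C \<le> h n k" for C
      using \<open>incseq _\<close> unfolding incseq_def by (meson order.trans)
    then show False using not_top unfolding filterlim_at_top eventually_sequentially by blast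
  qed
  then obtain C where C: "h n k \<le> C" for n by blast
  have "\<exists>B. \<forall>n. h n j \<le> B" if j: "j \<in> {1..d}" for j
  proof -
    obtain l where "(\<lambda>n. h n j / h n k powr (m j / m k)) \<longlonglongrightarrow> l" using h_ratio_limit[OF k j] by blast
    then have "Bseq (\<lambda>n. h n j / h n k powr (m j / m k))" using convergentI convergent_imp_Bseq by blast
    then obtain B where B: "norm (h n j / h n k powr (m j / m k)) \<le> B" for n
      unfolding Bseq_def by blast
    have "h n j \<le> B * C powr (m j / m k)" for n
    proof -
      have p: "0 < h n k powr (m j / m k)" using h_pos[OF k, of n] by simp
      have "h n j / h n k powr (m j / m k) \<le> B" using B[of n] unfolding real_norm_def by (rule abs_le_D1)
      then have "h n j \<le> B * h n k powr (m j / m k)" using p by (simp add: pos_divide_le_eq)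
      also have "\<dots> \<le> B * C powr (m j / m k)"
        using order.trans[OF norm_ge_zero B[of 0]] C[of n] h_pos[OF k, of n] m_ge_1[OF j] m_ge_1[OF k]
        by (intro mult_left_mono powr_mono2) auto
      finally show ?thesis .
    qed
    then show ?thesis by blast
  qed
  then obtain B where B: "h n j \<le> B j" if "j \<in> {1..d}" for n j by metis
  have "s n \<le> (\<Sum>j=1..d. B j)" for n unfolding s_def by (intro sum_mono B)
  then have "real n \<le> (\<Sum>j=1..d. B j)" for n using s_ge order.trans by blast
  then show False using reals_Archimedean2 not_le by blast
qed

text \<open>By Kronecker's lemma the count of a colour is asymptotically the sum of \<^term>\<open>mu i k * x i k\<close>,
  and \<^term>\<open>mu\<close> may be replaced by its limit in a weighted average.\<close>

lemma drawn_over_h: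
  assumes k: "k \<in> {1..d}"
  shows "(\<lambda>n. (\<Sum>i<n. x i k) / h n k) \<longlonglongrightarrow> 1 / m k"
proof -
  have mk: "1 \<le> m k" using m_ge_1[OF k] .
  note top = h_at_top[OF k]
  have z: "(\<lambda>n. (\<Sum>i<n. (a i k - mu i k) * x i k) / h n k) \<longlonglongrightarrow> 0"
    by (rule kronecker_lemma) (use h_mono[OF k] h_pos[OF k] top sum_a[OF k] in \<open>auto simp: h_def\<close>)
  have z0: "(\<lambda>n. h0 k / h n k) \<longlonglongrightarrow> 0"
    by (rule tendsto_divide_0[OF tendsto_const]) (rule filterlim_at_top_imp_at_infinity[OF top])
  have "(\<Sum>i<n. x i k * mu i k) / h n k = 1 - h0 k / h n k - (\<Sum>i<n. (a i k - mu i k) * x i k) / h n k" for n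
  proof -
    have "(\<Sum>i<n. (a i k - mu i k) * x i k) = (h n k - h0 k) - (\<Sum>i<n. x i k * mu i k)"
      by (simp add: h_def left_diff_distrib sum_subtractf mult.commute[of "x _ k"])
    then show ?thesis using h_pos[OF k, of n] by (simp add: diff_divide_distrib)
  qed
  then have one: "(\<lambda>n. (\<Sum>i<n. x i k * mu i k) / h n k) \<longlonglongrightarrow> 1"
    using tendsto_diff[OF tendsto_diff[OF tendsto_const[of 1] z0] z] by simp
  have topmx: "filterlim (\<lambda>n. \<Sum>i<n. x i k * mu i k) at_top sequentially"
  proof -
    have "filterlim (\<lambda>n. (\<Sum>i<n. x i k * mu i k) / h n k * h n k) at_top sequentially"
      by (rule filterlim_tendsto_pos_mult_at_top[OF one _ top]) simp
    then show ?thesis using h_pos[OF k] less_imp_neq[OF h_pos[OF k], symmetric] by simp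
  qed
  obtain B where B: "mu n k \<le> B" for n
    using convergent_imp_Bseq[OF convergentI[OF mu_lim[OF k]]]
    unfolding Bseq_def real_norm_def by (meson abs_le_D1)
  have Bp: "0 < B" using B[of 0] mu_ge_1[OF k, of 0] by linarith
  have topx: "filterlim (\<lambda>n. \<Sum>i<n. x i k) at_top sequentially"
  proof (rule filterlim_at_top_mono)
    show "filterlim (\<lambda>n. (1 / B) * (\<Sum>i<n. x i k * mu i k)) at_top sequentially"
      by (rule filterlim_tendsto_pos_mult_at_top[OF tendsto_const _ topmx]) (use Bp in simp)
    have "(\<Sum>i<n. x i k * mu i k) \<le> (\<Sum>i<n. x i k) * B" for n
      unfolding sum_distrib_right by (intro sum_mono mult_left_mono B x_nonneg k)
    then show "\<forall>\<^sub>F n in sequentially. (1 / B) * (\<Sum>i<n. x i k * mu i k) \<le> (\<Sum>i<n. x i k)"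
      using Bp by (simp add: field_simps)
  qed
  have ces: "(\<lambda>n. (\<Sum>i<n. x i k * mu i k) / (\<Sum>i<n. x i k)) \<longlonglongrightarrow> m k"
    by (rule weighted_cesaro) (use x_nonneg k topx mu_lim in auto)
  have "(\<lambda>n. (\<Sum>i<n. x i k * mu i k) / h n k / ((\<Sum>i<n. x i k * mu i k) / (\<Sum>i<n. x i k))) \<longlonglongrightarrow> 1 / m k"
    by (intro tendsto_divide one ces) (use mk in simp)
  moreover have "eventually (\<lambda>n. 0 < (\<Sum>i<n. x i k)) sequentially"
    "eventually (\<lambda>n. 0 < (\<Sum>i<n. x i k * mu i k)) sequentially"
    using topx topmx unfolding filterlim_at_top_dense by auto
  then have "eventually (\<lambda>n. (\<Sum>i<n. x i k * mu i k) / h n k / ((\<Sum>i<n. x i k * mu i k) / (\<Sum>i<n. x i k))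
     = (\<Sum>i<n. x i k) / h n k) sequentially"
    by eventually_elim simp
  ultimately show ?thesis by (simp add: tendsto_cong)
qed

lemma D_average: "(\<lambda>n. (\<Sum>i<n. D i) / real n) \<longlonglongrightarrow> N"
proof -
  have Suc_top: "filterlim (\<lambda>n. real (Suc n)) at_top sequentially"
    using filterlim_compose[OF filterlim_real_sequentially filterlim_Suc] .
  have "(\<lambda>n. (\<Sum>i<n. D i - c i) / real (Suc n)) \<longlonglongrightarrow> 0"
    by (rule kronecker_lemma) (use Suc_top sum_D in auto)
  then have "(\<lambda>n. (\<Sum>i<n. D i - c i) / real (Suc n) * (real (Suc n) / real n)) \<longlonglongrightarrow> 0 * 1"
    by (rule tendsto_mult) (rule LIMSEQ_Suc_n_over_n)
  then have 1: "(\<lambda>n. (\<Sum>i<n. D i - c i) / real n) \<longlonglongrightarrow> 0" by simp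
  have "(\<lambda>n. (\<Sum>i<n. 1 * c i) / (\<Sum>i<n. 1::real)) \<longlonglongrightarrow> N"
    by (rule weighted_cesaro) (use c_lim filterlim_real_sequentially in auto)
  then have 2: "(\<lambda>n. (\<Sum>i<n. c i) / real n) \<longlonglongrightarrow> N" by simp
  have "(\<lambda>n. (\<Sum>i<n. D i - c i) / real n + (\<Sum>i<n. c i) / real n) \<longlonglongrightarrow> 0 + N"
    by (intro tendsto_add 1 2)
  then show ?thesis by (simp add: sum_subtractf add_divide_distrib[symmetric])
qed

text \<open>The ratios to colour 1 determine all proportions. Adding the draws of all colours compares
  the average number of balls per stage, which tends to \<^term>\<open>N\<close>, with the count of colour 1
  and thus fixes the linear growth rate of that count.\<close>

theorem limits:
  assumes t: "t \<in> {1..d}" and m_eq: "\<And>k. k \<in> {1..t} \<Longrightarrow> m k = m 1"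
    and m_less: "\<And>k. k \<in> {t+1..d} \<Longrightarrow> m k < m 1"
  shows "\<exists>z xi. (\<forall>k\<in>{1..d}. (\<lambda>n. h n k / s n) \<longlonglongrightarrow> z k) \<and> 0 < z 1 \<and>
    (\<forall>j\<in>{t+1..d}. 0 < xi j \<and> (\<lambda>n. h n j / h n 1 powr (m j / m 1)) \<longlonglongrightarrow> xi j \<and>
       (\<lambda>n. real n powr (1 - m j / m 1) * (h n j / s n))
          \<longlonglongrightarrow> xi j * z 1 powr (m j / m 1) / (N * m 1) powr (1 - m j / m 1) \<and>
       (\<lambda>n. h n j / real n powr (m j / m 1)) \<longlonglongrightarrow> (N * m 1 * z 1) powr (m j / m 1) * xi j) \<and>
    (\<forall>k\<in>{1..d}. (\<lambda>n. (\<Sum>i<n. x i k) / real n powr (m k / m 1)) \<longlonglongrightarrow>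
       (if k \<in> {1..t} then N * z k
        else m 1 / m k * N * (xi k * z 1 powr (m k / m 1) / (N * m 1) powr (1 - m k / m 1))))"
proof -
  have m1: "1 \<le> m 1" using m_ge_1[OF d_pos] .
  obtain l where l: "0 < l k" "(\<lambda>n. h n k / h n 1 powr (m k / m 1)) \<longlonglongrightarrow> l k" if "k \<in> {1..d}" for k
    using h_ratio_limit[OF d_pos] by metis
  define r where "r k = (if k \<in> {1..t} then l k else 0)" for k
  have r0: "0 \<le> r k" if "k \<in> {1..d}" for k using l(1)[OF that] by (simp add: r_def)
  have r: "(\<lambda>n. h n k / h n 1) \<longlonglongrightarrow> r k" if k: "k \<in> {1..d}" for k
  proof (cases "k \<in> {1..t}")
    case True
    then show ?thesis using l(2)[OF k] m_eq[OF True] m1 h_pos[OF d_pos] by (simp add: r_def less_imp_le)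
  next
    case False
    then have "m k < m 1" using k m_less by auto
    then have neg: "m k / m 1 - 1 < 0" using m1 by simp
    have "(\<lambda>n. h n 1 powr (m k / m 1 - 1)) \<longlonglongrightarrow> 0"
      using tendsto_neg_powr[OF neg h_at_top[OF d_pos]] .
    then have "(\<lambda>n. h n k / h n 1 powr (m k / m 1) * h n 1 powr (m k / m 1 - 1)) \<longlonglongrightarrow> l k * 0"
      by (intro tendsto_mult l k)
    moreover have "h n k / h n 1 powr (m k / m 1) * h n 1 powr (m k / m 1 - 1) = h n k / h n 1" for n
      using h_pos[OF d_pos, of n] by (simp add: powr_diff)
    ultimately have "(\<lambda>n. h n k / h n 1) \<longlonglongrightarrow> 0" by simp
    then show ?thesis using False by (simp only: r_def if_False)
  qed
  have r1: "r 1 = 1"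
  proof (rule LIMSEQ_unique[OF r[OF d_pos]])
    show "(\<lambda>n. h n 1 / h n 1) \<longlonglongrightarrow> 1" using h_pos[OF d_pos] by (simp add: less_imp_neq[symmetric])
  qed
  define R where "R = (\<Sum>k=1..d. r k)"
  have "r 1 \<le> R" unfolding R_def by (rule member_le_sum[OF d_pos]) (auto simp: r0)
  then have R: "0 < R" using r1 by linarith
  define z where "z k = r k / R" for k
  have z1: "z 1 = 1 / R" by (simp only: z_def r1)
  have sR: "(\<lambda>n. s n / h n 1) \<longlonglongrightarrow> R"
    unfolding s_def R_def sum_divide_distrib by (intro tendsto_sum r)
  have z: "(\<lambda>n. h n k / s n) \<longlonglongrightarrow> z k" if "k \<in> {1..d}" for k
  proof -
    have "(\<lambda>n. (h n k / h n 1) / (s n / h n 1)) \<longlonglongrightarrow> r k / R"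
      by (intro tendsto_divide r that sR) (use R in simp)
    then show ?thesis using h_pos[OF d_pos] by (simp add: z_def less_imp_neq[symmetric])
  qed
  \<comment> \<open>Only the colours with the maximal mean contribute to this limit.\<close>
  have "(\<lambda>n. (\<Sum>i<n. D i) / h n 1) \<longlonglongrightarrow> R / m 1"
  proof -
    have "(\<Sum>i<n. D i) / h n 1 = (\<Sum>k=1..d. (\<Sum>i<n. x i k) / h n k * (h n k / h n 1))" for n
    proof -
      have "(\<Sum>i<n. D i) = (\<Sum>k=1..d. \<Sum>i<n. x i k)"
        unfolding D_sum[symmetric] by (rule sum.swap)
      then have "(\<Sum>i<n. D i) / h n 1 = (\<Sum>k=1..d. (\<Sum>i<n. x i k) / h n 1)"
        by (simp only: sum_divide_distrib)
      also have "\<dots> = (\<Sum>k=1..d. (\<Sum>i<n. x i k) / h n k * (h n k / h n 1))"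
      proof (intro sum.cong refl)
        fix k assume "k \<in> {1..d}"
        from h_pos[OF this, of n]
        show "(\<Sum>i<n. x i k) / h n 1 = (\<Sum>i<n. x i k) / h n k * (h n k / h n 1)" by simp
      qed
      finally show ?thesis .
    qed
    moreover have "(\<lambda>n. \<Sum>k=1..d. (\<Sum>i<n. x i k) / h n k * (h n k / h n 1)) \<longlonglongrightarrow> (\<Sum>k=1..d. 1 / m k * r k)"
      by (intro tendsto_sum tendsto_mult drawn_over_h r)
    moreover have "(\<Sum>k=1..d. 1 / m k * r k) = R / m 1"
      unfolding R_def sum_divide_distrib
    proof (intro sum.cong refl)
      show "1 / m k * r k = r k / m 1" for k
      proof (cases "k \<in> {1..t}")
        case True
        from m_eq[OF True] show ?thesis by simp
      next
        case False
        then have "r k = 0" by (simp only: r_def if_False)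
        then show ?thesis by simp
      qed
    qed
    ultimately show ?thesis by simp
  qed
  then have "(\<lambda>n. (\<Sum>i<n. D i) / real n / ((\<Sum>i<n. D i) / h n 1)) \<longlonglongrightarrow> N / (R / m 1)"
    by (rule tendsto_divide[OF D_average]) (use R m1 in simp)
  moreover have "eventually (\<lambda>n. (\<Sum>i<n. D i) / real n / ((\<Sum>i<n. D i) / h n 1) = h n 1 / real n) sequentially"
    using eventually_gt_at_top[of 0]
  proof eventually_elim
    case (elim n)
    have "0 < (\<Sum>i<n. D i)"
      using elim by (intro sum_pos) (auto intro: less_le_trans[OF zero_less_one D_ge_1])
    then show ?case by simp
  qed
  ultimately have h1: "(\<lambda>n. h n 1 / real n) \<longlonglongrightarrow> N * m 1 * z 1"
    unfolding z1 by (simp add: tendsto_cong)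
  have "(\<lambda>n. s n / h n 1 * (h n 1 / real n)) \<longlonglongrightarrow> R * (N * m 1 * z 1)"
    by (intro tendsto_mult sR h1)
  then have sn: "(\<lambda>n. s n / real n) \<longlonglongrightarrow> N * m 1"
    unfolding z1 using h_pos[OF d_pos] R by (simp add: less_imp_neq[symmetric])
  have pos: "0 < N * m 1" "0 < z 1" "0 < N * m 1 * z 1" unfolding z1 using N_pos m1 R by auto
  have hj: "(\<lambda>n. h n j / real n powr (m j / m 1)) \<longlonglongrightarrow> (N * m 1 * z 1) powr (m j / m 1) * l j"
    if j: "j \<in> {1..d}" for j
  proof -
    have "(\<lambda>n. (h n 1 / real n) powr (m j / m 1) * (h n j / h n 1 powr (m j / m 1)))
        \<longlonglongrightarrow> (N * m 1 * z 1) powr (m j / m 1) * l j"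
      by (rule tendsto_mult[OF tendsto_powr[OF h1 tendsto_const] l(2)[OF j]]) (use pos(3) in linarith)
    moreover have "(h n 1 / real n) powr (m j / m 1) * (h n j / h n 1 powr (m j / m 1))
        = h n j / real n powr (m j / m 1)" for n
      unfolding powr_divide
      by (rule frac_cancel) (use h_pos[OF d_pos, of n] in simp)
    ultimately show ?thesis by (simp only:)
  qed
  have lim_eq: "(N * m 1 * z 1) powr p * y / (N * m 1) = y * z 1 powr p / (N * m 1) powr (1 - p)" for p y
    using pos(1,2) by (rule powr_limit_eq)
  have Zj: "(\<lambda>n. real n powr (1 - m j / m 1) * (h n j / s n))
      \<longlonglongrightarrow> l j * z 1 powr (m j / m 1) / (N * m 1) powr (1 - m j / m 1)" if j: "j \<in> {1..d}" for j
  proof -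
    have "(\<lambda>n. h n j / real n powr (m j / m 1) / (s n / real n))
      \<longlonglongrightarrow> (N * m 1 * z 1) powr (m j / m 1) * l j / (N * m 1)"
      by (rule tendsto_divide[OF hj[OF j] sn]) (use pos(1) in linarith)
    moreover have "eventually (\<lambda>n. h n j / real n powr (m j / m 1) / (s n / real n)
        = real n powr (1 - m j / m 1) * (h n j / s n)) sequentially"
      using eventually_gt_at_top[of 0]
      by eventually_elim (simp add: powr_diff)
    ultimately show ?thesis unfolding lim_eq by (simp add: tendsto_cong)
  qed
  have X: "(\<lambda>n. (\<Sum>i<n. x i k) / real n powr (m k / m 1)) \<longlonglongrightarrow>
       (if k \<in> {1..t} then N * z k
        else m 1 / m k * N * (l k * z 1 powr (m k / m 1) / (N * m 1) powr (1 - m k / m 1)))"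
    if k: "k \<in> {1..d}" for k
  proof -
    have mk: "0 < m k" using m_ge_1[OF k] by simp
    have eq: "(\<Sum>i<n. x i k) / h n k * (h n k / y) = (\<Sum>i<n. x i k) / y" for n y
      using h_pos[OF k, of n] by simp
    show ?thesis
    proof (cases "k \<in> {1..t}")
      case True
      have "(\<lambda>n. h n k / s n * (s n / real n)) \<longlonglongrightarrow> z k * (N * m 1)"
        by (intro tendsto_mult z k sn)
      then have "(\<lambda>n. h n k / real n) \<longlonglongrightarrow> z k * (N * m 1)"
        using s_pos by (simp add: less_imp_neq[symmetric])
      from tendsto_mult[OF drawn_over_h[OF k] this]
      have "(\<lambda>n. (\<Sum>i<n. x i k) / real n) \<longlonglongrightarrow> 1 / m k * (z k * (N * m 1))" unfolding eq .
      then show ?thesis unfolding if_P[OF True] m_eq[OF True] using m1 by (simp add: mult.commute)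
    next
      case False
      from tendsto_mult[OF drawn_over_h[OF k] hj[OF k]]
      have "(\<lambda>n. (\<Sum>i<n. x i k) / real n powr (m k / m 1))
        \<longlonglongrightarrow> 1 / m k * ((N * m 1 * z 1) powr (m k / m 1) * l k)" unfolding eq .
      moreover have "1 / m k * ((N * m 1 * z 1) powr (m k / m 1) * l k) =
          m 1 / m k * N * (l k * z 1 powr (m k / m 1) / (N * m 1) powr (1 - m k / m 1))"
        unfolding lim_eq[symmetric] using N_pos m1 by simp
      ultimately show ?thesis unfolding if_not_P[OF False] by (simp only:)
    qed
  qed
  have sub: "j \<in> {1..d}" if "j \<in> {t+1..d}" for j using that by auto
  show ?thesis
  proof (rule exI[of _ z], rule exI[of _ l], intro conjI ballI)
    show "(\<lambda>n. h n k / s n) \<longlonglongrightarrow> z k" if "k \<in> {1..d}" for k by (rule z[OF that])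
    show "0 < z 1" by (rule pos(2))
    fix j assume "j \<in> {t+1..d}"
    note j = sub[OF this]
    show "0 < l j" "(\<lambda>n. h n j / h n 1 powr (m j / m 1)) \<longlonglongrightarrow> l j"
      by (rule l[OF j])+
    show "(\<lambda>n. real n powr (1 - m j / m 1) * (h n j / s n))
        \<longlonglongrightarrow> l j * z 1 powr (m j / m 1) / (N * m 1) powr (1 - m j / m 1)" by (rule Zj[OF j])
    show "(\<lambda>n. h n j / real n powr (m j / m 1)) \<longlonglongrightarrow> (N * m 1 * z 1) powr (m j / m 1) * l j"
      by (rule hj[OF j])
  next
    fix k assume "k \<in> {1..d}"
    then show "(\<lambda>n. (\<Sum>i<n. x i k) / real n powr (m k / m 1)) \<longlonglongrightarrow>
       (if k \<in> {1..t} then N * z k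
        else m 1 / m k * N * (l k * z 1 powr (m k / m 1) / (N * m 1) powr (1 - m k / m 1)))" by (rule X)
  qed
qed

end

section \<open>The urn: elementary bounds and measurability\<close>

context reinforced_urn
begin

text \<open>Colour counts and total after \<^term>\<open>n\<close> stages, and the two filtrations of the model:
  \<^term>\<open>G n\<close> extends \<^term>\<open>F n\<close> by the number of balls to be drawn next.\<close>

abbreviation "H \<equiv> urn_H H0 X A"
abbreviation "S \<equiv> urn_S d H0 X A"
abbreviation "F \<equiv> urn_F M d D X A"
abbreviation "G \<equiv> urn_G M d D X A"

lemma X_sum_Suc: "\<omega> \<in> space M \<Longrightarrow> (\<Sum>k=1..d. X (Suc n) k \<omega>) = D (Suc n) \<omega>"
  using X_total by simp

lemma D_Suc:
  assumes "\<omega> \<in> space M"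
  shows "1 \<le> D (Suc n) \<omega>" "D (Suc n) \<omega> \<le> C1" "D (Suc n) \<omega> \<le> S n \<omega>"
  using D_range assms by (auto simp: Suc_le_eq)

lemma X_le_D: "\<omega> \<in> space M \<Longrightarrow> k \<in> {1..d} \<Longrightarrow> X (Suc n) k \<omega> \<le> D (Suc n) \<omega>"
  unfolding X_sum_Suc[symmetric] by (rule member_le_sum) auto

lemma X_le: "\<omega> \<in> space M \<Longrightarrow> k \<in> {1..d} \<Longrightarrow> X (Suc n) k \<omega> \<le> C1"
  using X_le_D[of \<omega> k n] D_Suc(2)[of \<omega> n] by linarith

lemma A_ge: "\<omega> \<in> space M \<Longrightarrow> k \<in> {1..d} \<Longrightarrow> 1 \<le> A (Suc n) k \<omega>"
  using A_range by simp

lemma H_Suc: "H (Suc n) k \<omega> = H n k \<omega> + A (Suc n) k \<omega> * X (Suc n) k \<omega>"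
  by (simp add: urn_H_def)

lemma H_ge_1: "k \<in> {1..d} \<Longrightarrow> 1 \<le> H n k \<omega>"
  unfolding urn_H_def using initial by (auto simp: Suc_le_eq intro: trans_less_add1)

lemma rv_events_eq: "rv_events M f = {f -` B \<inter> space M | B. True}"
  unfolding rv_events_def by (subst sets_vimage_algebra2) auto

lemma measurable_of_rv_events:
  assumes "rv_events M f \<subseteq> sets Q" "space Q = space M"
  shows "f \<in> measurable Q (count_space UNIV)"
  using assms by (intro measurableI) (auto simp: rv_events_eq)

lemma rv_events_sub: "f \<in> measurable M (count_space UNIV) \<Longrightarrow> rv_events M f \<subseteq> sets M"
  unfolding rv_events_eq by (auto intro: measurable_sets)

text \<open>The generator of \<^term>\<open>F n\<close>.\<close>

abbreviation (input) "gen n \<equiv> (\<Union>i\<in>{1..n}. rv_events M (D i) \<union> vec_events M d (X i) \<union> vec_events M d (A i))"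

lemma gen_sub: "gen n \<subseteq> sets M"
  unfolding vec_events_def using D_rv X_rv A_rv by (intro UN_least Un_least rv_events_sub) auto

lemma gen_Pow: "gen n \<subseteq> Pow (space M)"
  using gen_sub sets.space_closed by (rule order.trans)

lemma sets_F: "sets (F n) = sigma_sets (space M) (gen n)"
  unfolding urn_F_def using gen_Pow by (rule sets_measure_of)

lemma space_F [simp]: "space (F n) = space M"
  unfolding urn_F_def using gen_Pow by (rule space_measure_of)

lemma sets_F_sub: "sets (F n) \<subseteq> sets M"
  unfolding sets_F using gen_sub by (rule sets.sigma_sets_subset)

lemma subalgebra_F: "subalgebra M (F n)"
  using sets_F_sub by (simp add: subalgebra_def)

lemma F_mono: "i \<le> n \<Longrightarrow> sets (F i) \<subseteq> sets (F n)"
  unfolding sets_F by (intro sigma_sets_mono' UN_mono) auto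

lemma G_gen_sub: "sets (F n) \<union> rv_events M (D (n + 1)) \<subseteq> sets M"
  using sets_F_sub rv_events_sub D_rv by simp

lemma sets_G: "sets (G n) = sigma_sets (space M) (sets (F n) \<union> rv_events M (D (n + 1)))"
  unfolding urn_G_def using order.trans[OF G_gen_sub sets.space_closed] by (rule sets_measure_of)

lemma space_G [simp]: "space (G n) = space M"
  unfolding urn_G_def using order.trans[OF G_gen_sub sets.space_closed] by (rule space_measure_of)

lemma sets_G_sub: "sets (G n) \<subseteq> sets M"
  unfolding sets_G using G_gen_sub by (rule sets.sigma_sets_subset)

lemma subalgebra_G: "subalgebra M (G n)"
  using sets_G_sub by (simp add: subalgebra_def)

lemma F_sub_G: "sets (F n) \<subseteq> sets (G n)"
  unfolding sets_G by auto

text \<open>The information available once the draw of stage \<^term>\<open>n + 1\<close> is known, but not yet its replacement factors.\<close>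

definition GX :: "nat \<Rightarrow> 'a measure" where
  "GX n = sigma (space M) (sets (G n) \<union> vec_events M d (X (n + 1)))"

lemma GX_gen_sub: "sets (G n) \<union> vec_events M d (X (n + 1)) \<subseteq> sets M"
  unfolding vec_events_def using sets_G_sub X_rv by (intro UN_least Un_least rv_events_sub) auto

lemma sets_GX: "sets (GX n) = sigma_sets (space M) (sets (G n) \<union> vec_events M d (X (n + 1)))"
  unfolding GX_def using order.trans[OF GX_gen_sub sets.space_closed] by (rule sets_measure_of)

lemma space_GX [simp]: "space (GX n) = space M"
  unfolding GX_def using order.trans[OF GX_gen_sub sets.space_closed] by (rule space_measure_of)

lemma G_sub_GX: "sets (G n) \<subseteq> sets (GX n)"
  unfolding sets_GX by auto

lemma F_sub_G_meas: "f \<in> borel_measurable (F n) \<Longrightarrow> f \<in> borel_measurable (G n)"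
  for f :: "'a \<Rightarrow> real"
  by (rule measurable_from_subalg) (auto simp: subalgebra_def F_sub_G)

lemma G_sub_GX_meas: "f \<in> borel_measurable (G n) \<Longrightarrow> f \<in> borel_measurable (GX n)"
  for f :: "'a \<Rightarrow> real"
  by (rule measurable_from_subalg) (auto simp: subalgebra_def G_sub_GX)

lemma F_mono_meas: "f \<in> borel_measurable (F i) \<Longrightarrow> i \<le> n \<Longrightarrow> f \<in> borel_measurable (F n)"
  for f :: "'a \<Rightarrow> real"
  by (rule measurable_from_subalg) (auto simp: subalgebra_def F_mono)

lemmas F_sub_M_meas = measurable_from_subalg[OF subalgebra_F]
lemmas G_sub_M_meas = measurable_from_subalg[OF subalgebra_G]

lemma real_of_rv_events:
  assumes "rv_events M f \<subseteq> sets Q" "space Q = space M"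
  shows "(\<lambda>\<omega>. real (f \<omega>)) \<in> borel_measurable Q"
  by (rule measurable_compose[OF measurable_of_rv_events[OF assms]]) simp

lemma measurable_F:
  assumes "1 \<le> i" "i \<le> n"
  shows D_F: "(\<lambda>\<omega>. real (D i \<omega>)) \<in> borel_measurable (F n)"
    and X_F: "k \<in> {1..d} \<Longrightarrow> (\<lambda>\<omega>. real (X i k \<omega>)) \<in> borel_measurable (F n)"
    and A_F: "k \<in> {1..d} \<Longrightarrow> (\<lambda>\<omega>. real (A i k \<omega>)) \<in> borel_measurable (F n)"
proof -
  have sub: "gen n \<subseteq> sets (F n)" unfolding sets_F by (rule sigma_sets_superset_generator)
  have i: "i \<in> {1..n}" using assms by simp
  have vec: "rv_events M (V k) \<subseteq> vec_events M d V" if "k \<in> {1..d}" for V :: "nat \<Rightarrow> 'a \<Rightarrow> nat" and k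
    unfolding vec_events_def using that by (rule UN_upper)
  have upper: "rv_events M (D i) \<union> vec_events M d (X i) \<union> vec_events M d (A i) \<subseteq> sets (F n)"
    using UN_upper[OF i] sub by (rule order.trans)
  show "(\<lambda>\<omega>. real (D i \<omega>)) \<in> borel_measurable (F n)"
    by (rule real_of_rv_events) (use upper in auto)
  show "(\<lambda>\<omega>. real (X i k \<omega>)) \<in> borel_measurable (F n)" if "k \<in> {1..d}"
    by (rule real_of_rv_events) (use upper vec[OF that, of "X i"] in auto)
  show "(\<lambda>\<omega>. real (A i k \<omega>)) \<in> borel_measurable (F n)" if "k \<in> {1..d}"
    by (rule real_of_rv_events) (use upper vec[OF that, of "A i"] in auto)
qed

lemma H_F: "k \<in> {1..d} \<Longrightarrow> (\<lambda>\<omega>. real (H n k \<omega>)) \<in> borel_measurable (F n)"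
  unfolding urn_H_def of_nat_add of_nat_sum of_nat_mult
  by (intro borel_measurable_add borel_measurable_sum borel_measurable_times A_F X_F) auto

lemma S_F: "(\<lambda>\<omega>. real (S n \<omega>)) \<in> borel_measurable (F n)"
  unfolding urn_S_def of_nat_sum by (intro borel_measurable_sum H_F) auto

lemma D_G: "(\<lambda>\<omega>. real (D (Suc n) \<omega>)) \<in> borel_measurable (G n)"
  by (rule real_of_rv_events) (auto simp: sets_G)

lemma X_GX: "k \<in> {1..d} \<Longrightarrow> (\<lambda>\<omega>. real (X (Suc n) k \<omega>)) \<in> borel_measurable (GX n)"
  by (rule real_of_rv_events) (auto simp: sets_GX vec_events_def)

lemma measurable_M:
  shows D_M: "(\<lambda>\<omega>. real (D (Suc n) \<omega>)) \<in> borel_measurable M"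
    and X_M: "k \<in> {1..d} \<Longrightarrow> (\<lambda>\<omega>. real (X (Suc n) k \<omega>)) \<in> borel_measurable M"
    and A_M: "k \<in> {1..d} \<Longrightarrow> (\<lambda>\<omega>. real (A (Suc n) k \<omega>)) \<in> borel_measurable M"
    and H_M: "k \<in> {1..d} \<Longrightarrow> (\<lambda>\<omega>. real (H n k \<omega>)) \<in> borel_measurable M"
    and S_M: "(\<lambda>\<omega>. real (S n \<omega>)) \<in> borel_measurable M"
proof -
  show "(\<lambda>\<omega>. real (D (Suc n) \<omega>)) \<in> borel_measurable M"
    by (rule F_sub_M_meas[OF D_F[of "Suc n" "Suc n"]]) auto
  show "(\<lambda>\<omega>. real (X (Suc n) k \<omega>)) \<in> borel_measurable M" if "k \<in> {1..d}"
    by (rule F_sub_M_meas[OF X_F[OF _ order.refl that]]) simp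
  show "(\<lambda>\<omega>. real (A (Suc n) k \<omega>)) \<in> borel_measurable M" if "k \<in> {1..d}"
    by (rule F_sub_M_meas[OF A_F[OF _ order.refl that]]) simp
  show "(\<lambda>\<omega>. real (H n k \<omega>)) \<in> borel_measurable M" if "k \<in> {1..d}"
    by (rule F_sub_M_meas[OF H_F[OF that]])
  show "(\<lambda>\<omega>. real (S n \<omega>)) \<in> borel_measurable M"
    by (rule F_sub_M_meas[OF S_F])
qed

section \<open>Conditional means and second moments of the draws\<close>

text \<open>Given \<^term>\<open>G n\<close>, the mean of \<^term>\<open>X (Suc n) k \<omega>\<close> is
  \<^term>\<open>real (D (Suc n) \<omega>) * real (H n k \<omega>) / real (S n \<omega>)\<close>. This is
  stated here after division by the colour count. The count is decomposed over the events that the whole draw equals a given vector, whose conditional probabilities are hypergeometric.\<close>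

lemma integral_mult_X_over_H:
  fixes f :: "'a \<Rightarrow> real"
  assumes k: "k \<in> {1..d}" and f: "f \<in> borel_measurable (G n)" and int: "integrable M f"
  shows "(\<integral>\<omega>. f \<omega> * (real (X (Suc n) k \<omega>) / real (H n k \<omega>)) \<partial>M)
       = (\<integral>\<omega>. f \<omega> * (real (D (Suc n) \<omega>) / real (S n \<omega>)) \<partial>M)"
proof -
  interpret sigma_finite_subalgebra M "G n" by (rule sigma_finite_subalgebraI[OF subalgebra_G])
  note [measurable] = X_M[OF k] H_M[OF k] S_M D_M G_sub_M_meas[OF f]
  define E where "E x = {\<omega> \<in> space M. \<forall>j\<in>{1..d}. X (Suc n) j \<omega> = x j}" for x :: "nat \<Rightarrow> nat"
  have EM [measurable]: "E x \<in> sets M" for x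
  proof -
    have [measurable]: "X (Suc n) j \<in> measurable M (count_space UNIV)" if "j \<in> {1..d}" for j
      using X_rv that by simp
    show ?thesis unfolding E_def by measurable
  qed
  define B where "B = PiE {1..d} (\<lambda>_::nat. {..C1})"
  have finB: "finite B" unfolding B_def by (intro finite_PiE) auto
  define g where "g \<omega> = f \<omega> * (1 / real (H n k \<omega>))" for \<omega>
  have gG: "g \<in> borel_measurable (G n)"
    unfolding g_def by (intro borel_measurable_times f borel_measurable_divide F_sub_G_meas[OF H_F[OF k]] borel_measurable_const)
  have gi: "integrable M g"
    unfolding g_def by (rule integrable_mult_bounded[OF int, of _ 1]) (use H_ge_1[OF k] H_M[OF k] in \<open>auto simp: divide_le_eq Suc_le_eq\<close>)
  have gE: "integrable M (\<lambda>\<omega>. g \<omega> * indicator (E x) \<omega>)" for x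
    by (rule integrable_mult_bounded[OF gi, of _ 1]) (auto simp: indicator_def)
  have gC: "integrable M (\<lambda>\<omega>. g \<omega> * real_cond_exp M (G n) (indicator (E x)) \<omega>)"
    "(\<integral>\<omega>. g \<omega> * real_cond_exp M (G n) (indicator (E x)) \<omega> \<partial>M) = (\<integral>\<omega>. g \<omega> * indicator (E x) \<omega> \<partial>M)" for x
    using real_cond_exp_intg[OF gE gG] by auto
  have Xdec: "real (X (Suc n) k \<omega>) = (\<Sum>x\<in>B. real (x k) * indicator (E x) \<omega>)" if w: "\<omega> \<in> space M" for \<omega>
  proof -
    define y where "y = restrict (\<lambda>j. X (Suc n) j \<omega>) {1..d}"
    have yB: "y \<in> B" using X_le[OF w] by (auto simp: y_def B_def)
    have "\<omega> \<in> E x \<longleftrightarrow> x = y" if "x \<in> B" for x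
      using that w by (auto simp: E_def y_def B_def PiE_def extensional_def fun_eq_iff)
    then have "(\<Sum>x\<in>B. real (x k) * indicator (E x) \<omega>) = (\<Sum>x\<in>B. if x = y then real (x k) else 0)"
      by (intro sum.cong) auto
    then show ?thesis using yB finB k by (simp add: y_def)
  qed
  have "AE \<omega> in M. \<forall>x\<in>B. real_cond_exp M (G n) (indicator (E x)) \<omega>
      = mv_hypergeometric d (\<lambda>k. H n k \<omega>) (D (Suc n) \<omega>) x"
    using X_cond finB by (intro AE_finite_allI) (auto simp: E_def)
  then have mean: "AE \<omega> in M. (\<Sum>x\<in>B. real (x k) * real_cond_exp M (G n) (indicator (E x)) \<omega>)
      = real (D (Suc n) \<omega>) * real (H n k \<omega>) / real (S n \<omega>)"
    using AE_space
  proof eventually_elim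
    case (elim \<omega>)
    have "(\<Sum>x\<in>B. real (x k) * real_cond_exp M (G n) (indicator (E x)) \<omega>)
      = (\<Sum>x\<in>B. real (x k) * mv_hypergeometric d (\<lambda>k. H n k \<omega>) (D (Suc n) \<omega>) x)"
      using elim(1) by (intro sum.cong) auto
    also have "\<dots> = real (D (Suc n) \<omega>) * real (H n k \<omega>) / real (S n \<omega>)"
      unfolding B_def urn_S_def
      by (rule mv_hypergeometric_mean[OF k])
         (use D_Suc[OF elim(2), of n] H_ge_1[OF k, of n \<omega>] in \<open>auto simp: urn_S_def\<close>)
    finally show ?case .
  qed
  have "(\<integral>\<omega>. f \<omega> * (real (X (Suc n) k \<omega>) / real (H n k \<omega>)) \<partial>M)
      = (\<integral>\<omega>. (\<Sum>x\<in>B. real (x k) * (g \<omega> * indicator (E x) \<omega>)) \<partial>M)"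
  proof (rule Bochner_Integration.integral_cong[OF refl])
    fix \<omega> assume w: "\<omega> \<in> space M"
    have "f \<omega> * (real (X (Suc n) k \<omega>) / real (H n k \<omega>)) = g \<omega> * real (X (Suc n) k \<omega>)" by (simp add: g_def)
    then show "f \<omega> * (real (X (Suc n) k \<omega>) / real (H n k \<omega>)) = (\<Sum>x\<in>B. real (x k) * (g \<omega> * indicator (E x) \<omega>))"
      unfolding Xdec[OF w] by (simp add: sum_distrib_left mult.left_commute)
  qed
  also have "\<dots> = (\<Sum>x\<in>B. real (x k) * (\<integral>\<omega>. g \<omega> * indicator (E x) \<omega> \<partial>M))"
    using gE by (subst Bochner_Integration.integral_sum) auto
  also have "\<dots> = (\<integral>\<omega>. (\<Sum>x\<in>B. real (x k) * (g \<omega> * real_cond_exp M (G n) (indicator (E x)) \<omega>)) \<partial>M)"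
    unfolding gC(2)[symmetric] using gC(1) by (subst Bochner_Integration.integral_sum) auto
  also have "\<dots> = (\<integral>\<omega>. f \<omega> * (real (D (Suc n) \<omega>) / real (S n \<omega>)) \<partial>M)"
  proof (rule integral_cong_AE)
    show "AE \<omega> in M. (\<Sum>x\<in>B. real (x k) * (g \<omega> * real_cond_exp M (G n) (indicator (E x)) \<omega>))
        = f \<omega> * (real (D (Suc n) \<omega>) / real (S n \<omega>))"
      using mean
    proof eventually_elim
      case (elim \<omega>)
      have "(\<Sum>x\<in>B. real (x k) * (g \<omega> * real_cond_exp M (G n) (indicator (E x)) \<omega>))
          = g \<omega> * (real (D (Suc n) \<omega>) * real (H n k \<omega>) / real (S n \<omega>))"
        unfolding elim[symmetric] by (simp add: sum_distrib_left mult.left_commute)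
      then show ?case using H_ge_1[OF k, of n \<omega>] by (simp add: g_def)
    qed
  qed (use gC(1) in \<open>auto intro!: borel_measurable_sum\<close>)
  finally show ?thesis .
qed

lemma X_over_H_bound: "\<omega> \<in> space M \<Longrightarrow> k \<in> {1..d} \<Longrightarrow> \<bar>real (X (Suc n) k \<omega>) / real (H n k \<omega>)\<bar> \<le> real C1"
  using frac_le[of "real C1" "real (X (Suc n) k \<omega>)" 1 "real (H n k \<omega>)"]
    X_le[of \<omega> k n] H_ge_1[of k n \<omega>] by simp

lemma X_over_H_M: "k \<in> {1..d} \<Longrightarrow> (\<lambda>\<omega>. real (X (Suc n) k \<omega>) / real (H n k \<omega>)) \<in> borel_measurable M"
  by (intro borel_measurable_divide X_M H_M)

text \<open>The second moment of the relative number of balls of colour \<^term>\<open>k\<close> drawn at stage \<^term>\<open>n + 1\<close>.\<close>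

definition draw_ratio_sq :: "nat \<Rightarrow> nat \<Rightarrow> real" where
  "draw_ratio_sq k n = (\<integral>\<omega>. (real (X (Suc n) k \<omega>) / real (H n k \<omega>))\<^sup>2 \<partial>M)"

lemma integrable_X_over_H_sq:
  assumes k: "k \<in> {1..d}"
  shows "integrable M (\<lambda>\<omega>. (real (X (Suc n) k \<omega>) / real (H n k \<omega>))\<^sup>2)"
proof (rule integrable_const_bound[of _ "(real C1)\<^sup>2"], rule AE_I2)
  fix \<omega> assume "\<omega> \<in> space M"
  from X_over_H_bound[OF this k]
  have "\<bar>real (X (Suc n) k \<omega>) / real (H n k \<omega>)\<bar> \<le> \<bar>real C1\<bar>" by simp
  then show "norm ((real (X (Suc n) k \<omega>) / real (H n k \<omega>))\<^sup>2) \<le> (real C1)\<^sup>2"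
    unfolding abs_le_square_iff by simp
qed (intro borel_measurable_power X_over_H_M k)

text \<open>The estimate behind all second moment bounds, which holds for every outcome. Since replacement
  factors are at least 1, a draw of colour \<^term>\<open>k\<close> at stage \<^term>\<open>i + 1\<close> lowers the reciprocal of
  the colour count by at least half the square of this reciprocal, and these decreases telescope.\<close>

lemma sum_X_sq_over_H_sq_le:
  assumes w: "\<omega> \<in> space M" and k: "k \<in> {1..d}"
  shows "(\<Sum>i<n. (real (X (Suc i) k \<omega>) / real (H i k \<omega>))\<^sup>2) \<le> 2 * (real C1)\<^sup>2"
proof -
  let ?h = "\<lambda>i. real (H i k \<omega>)"
  have h1: "1 \<le> ?h i" for i using H_ge_1[OF k, of i \<omega>] by simp
  have "(real (X (Suc i) k \<omega>) / ?h i)\<^sup>2 \<le> 2 * (real C1)\<^sup>2 * (1 / ?h i - 1 / ?h (Suc i))" for i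
  proof (cases "X (Suc i) k \<omega> = 0")
    case True
    then show ?thesis by (simp add: H_Suc)
  next
    case False
    have "1 \<le> A (Suc i) k \<omega> * X (Suc i) k \<omega>"
      using False A_ge[OF w k, of i] by simp
    then have "H i k \<omega> + 1 \<le> H (Suc i) k \<omega>" unfolding H_Suc by (rule add_left_mono)
    then have "?h i + 1 \<le> ?h (Suc i)" by linarith
    then have "1 / ?h i - 1 / ?h (Suc i) \<ge> 1 / ?h i - 1 / (?h i + 1)"
      using h1[of i] by (intro diff_left_mono divide_left_mono mult_pos_pos) auto
    moreover have "1 / ?h i - 1 / (?h i + 1) = 1 / (?h i * (?h i + 1))"
      using h1[of i] by (simp add: field_simps)
    moreover have "1 / (?h i * (?h i + 1)) \<ge> 1 / (2 * (?h i)\<^sup>2)"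
    proof (rule frac_le)
      have "?h i * 1 \<le> ?h i * ?h i" using h1[of i] by (intro mult_left_mono) auto
      then show "?h i * (?h i + 1) \<le> 2 * (?h i)\<^sup>2" by (simp add: power2_eq_square distrib_left)
      show "0 < ?h i * (?h i + 1)" using h1[of i] by (intro mult_pos_pos) auto
    qed auto
    ultimately have "1 / (2 * (?h i)\<^sup>2) \<le> 1 / ?h i - 1 / ?h (Suc i)" by linarith
    then have "2 * (real C1)\<^sup>2 * (1 / (2 * (?h i)\<^sup>2)) \<le> 2 * (real C1)\<^sup>2 * (1 / ?h i - 1 / ?h (Suc i))"
      by (intro mult_left_mono) auto
    moreover have "(real (X (Suc i) k \<omega>) / ?h i)\<^sup>2 \<le> (real C1)\<^sup>2 / (?h i)\<^sup>2"
      unfolding power_divide using X_le[OF w k, of i] by (intro divide_right_mono power_mono) auto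
    ultimately show ?thesis by simp
  qed
  then have "(\<Sum>i<n. (real (X (Suc i) k \<omega>) / ?h i)\<^sup>2) \<le> (\<Sum>i<n. 2 * (real C1)\<^sup>2 * (1 / ?h i - 1 / ?h (Suc i)))"
    by (rule sum_mono)
  also have "\<dots> = 2 * (real C1)\<^sup>2 * (1 / ?h 0 - 1 / ?h n)"
    unfolding sum_distrib_left[symmetric] by (subst sum_lessThan_telescope'[of "\<lambda>i. 1 / ?h i"]) simp
  also have "\<dots> \<le> 2 * (real C1)\<^sup>2 * 1"
  proof (intro mult_left_mono)
    have "1 / ?h 0 \<le> 1" "0 \<le> 1 / ?h n" using h1[of 0] h1[of n] by auto
    then show "1 / ?h 0 - 1 / ?h n \<le> 1" by linarith
  qed simp
  finally show ?thesis by simp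
qed

lemma summable_draw_ratio_sq:
  assumes k: "k \<in> {1..d}"
  shows "summable (draw_ratio_sq k)"
proof (rule summableI_nonneg_bounded)
  show "0 \<le> draw_ratio_sq k n" for n unfolding draw_ratio_sq_def by simp
  fix n
  have "(\<Sum>i<n. draw_ratio_sq k i) = (\<integral>\<omega>. (\<Sum>i<n. (real (X (Suc i) k \<omega>) / real (H i k \<omega>))\<^sup>2) \<partial>M)"
    unfolding draw_ratio_sq_def using integrable_X_over_H_sq[OF k] by (subst Bochner_Integration.integral_sum) auto
  also have "\<dots> \<le> (\<integral>\<omega>. 2 * (real C1)\<^sup>2 \<partial>M)"
    using integrable_X_over_H_sq[OF k] sum_X_sq_over_H_sq_le[OF _ k]
    by (intro integral_mono) auto
  finally show "(\<Sum>i<n. draw_ratio_sq k i) \<le> 2 * (real C1)\<^sup>2" by (simp add: prob_space)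
qed

text \<open>The replacement factors of stage \<^term>\<open>n + 1\<close> are independent of everything measurable with respect to \<^term>\<open>GX n\<close>.\<close>

lemma integral_A_mult:
  fixes g :: "nat \<Rightarrow> real" and Y :: "'a \<Rightarrow> real"
  assumes k: "k \<in> {1..d}" and Y: "Y \<in> borel_measurable (GX n)" and intY: "integrable M Y"
    and intg: "integrable M (\<lambda>\<omega>. g (A (Suc n) k \<omega>))"
  shows "integrable M (\<lambda>\<omega>. g (A (Suc n) k \<omega>) * Y \<omega>)"
    and "(\<integral>\<omega>. g (A (Suc n) k \<omega>) * Y \<omega> \<partial>M) = (\<integral>\<omega>. g (A (Suc n) k \<omega>) \<partial>M) * (\<integral>\<omega>. Y \<omega> \<partial>M)"
proof -
  have ind: "indep_set (sigma_sets (space M) (vec_events M d (A (Suc n)))) (sets (GX n))"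
    using A_indep by (simp add: sets_GX)
  have "indep_var borel (\<lambda>\<omega>. g (A (Suc n) k \<omega>)) borel Y"
    unfolding indep_var_eq
  proof (intro conjI)
    show "random_variable borel (\<lambda>\<omega>. g (A (Suc n) k \<omega>))" "random_variable borel Y"
      using intg intY by auto
    let ?P = "{(\<lambda>\<omega>. g (A (Suc n) k \<omega>)) -` B \<inter> space M | B. B \<in> sets borel}"
    let ?Q = "{Y -` B \<inter> space M | B. B \<in> sets borel}"
    have P: "sigma_sets (space M) ?P \<subseteq> sigma_sets (space M) (vec_events M d (A (Suc n)))"
    proof (rule sigma_sets_mono, clarify)
      fix B :: "real set"
      have "(\<lambda>\<omega>. g (A (Suc n) k \<omega>)) -` B \<inter> space M = A (Suc n) k -` (g -` B) \<inter> space M" by auto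
      also have "\<dots> \<in> vec_events M d (A (Suc n))"
        unfolding vec_events_def rv_events_eq using k by blast
      finally show "(\<lambda>\<omega>. g (A (Suc n) k \<omega>)) -` B \<inter> space M \<in> sigma_sets (space M) (vec_events M d (A (Suc n)))"
        by (rule sigma_sets.Basic)
    qed
    have Q: "sigma_sets (space M) ?Q \<subseteq> sets (GX n)"
      using sets.sigma_sets_subset[of ?Q "GX n"] measurable_sets[OF Y] by auto
    show "indep_set (sigma_sets (space M) ?P) (sigma_sets (space M) ?Q)"
      using ind unfolding indep_set_def
      by (rule indep_sets_mono_sets) (use P Q in \<open>auto split: bool.split\<close>)
  qed
  from indep_var_integrable[OF this intg intY] indep_var_lebesgue_integral[OF this intg intY]
  show "integrable M (\<lambda>\<omega>. g (A (Suc n) k \<omega>) * Y \<omega>)"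
    "(\<integral>\<omega>. g (A (Suc n) k \<omega>) * Y \<omega> \<partial>M) = (\<integral>\<omega>. g (A (Suc n) k \<omega>) \<partial>M) * (\<integral>\<omega>. Y \<omega> \<partial>M)"
    by auto
qed

lemma X_over_H_GX:
  assumes "k \<in> {1..d}"
  shows "(\<lambda>\<omega>. real (X (Suc n) k \<omega>) / real (H n k \<omega>)) \<in> borel_measurable (GX n)"
  by (intro borel_measurable_divide X_GX G_sub_GX_meas F_sub_G_meas H_F assms)

end

section \<open>Martingales of the urn\<close>

context reinforced_urn
begin

text \<open>The conditional mean of the number of balls drawn at stage \<^term>\<open>n + 1\<close>.\<close>

abbreviation "cD n \<equiv> real_cond_exp M (F n) (\<lambda>\<omega>. real (D (Suc n) \<omega>))"

lemma D_int: "integrable M (\<lambda>\<omega>. real (D (Suc n) \<omega>))"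
  by (rule integrable_const_bound[of _ "real C1"]) (use D_Suc(2) D_M in \<open>auto intro!: AE_I2\<close>)

lemma cD_bounds: "AE \<omega> in M. 1 \<le> cD n \<omega>" "AE \<omega> in M. cD n \<omega> \<le> real C1"
proof -
  interpret sigma_finite_subalgebra M "F n" by (rule sigma_finite_subalgebraI[OF subalgebra_F])
  show "AE \<omega> in M. 1 \<le> cD n \<omega>"
    by (rule real_cond_exp_ge_c[OF D_int]) (use D_Suc(1) in \<open>force intro: AE_I2\<close>)
  show "AE \<omega> in M. cD n \<omega> \<le> real C1"
    by (rule real_cond_exp_le_c[OF D_int]) (use D_Suc(2) in \<open>force intro: AE_I2\<close>)
qed

lemma draw_number_fluctuations_summable:
  "AE \<omega> in M. summable (\<lambda>n. (real (D (Suc n) \<omega>) - cD n \<omega>) / real (Suc n))"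
proof (rule martingale_differences_summable[where F=F])
  have cF: "cD n \<in> borel_measurable (F n)" for n by simp
  note [measurable] = F_sub_M_meas[OF cF] D_M
  have b: "AE \<omega> in M. norm (((real (D (Suc n) \<omega>) - cD n \<omega>) / real (Suc n))\<^sup>2) \<le> (real C1)\<^sup>2 * inverse ((real (Suc n))\<^sup>2)" for n
    using cD_bounds[of n] AE_space
  proof eventually_elim
    case (elim \<omega>)
    have "\<bar>real (D (Suc n) \<omega>) - cD n \<omega>\<bar> \<le> \<bar>real C1\<bar>"
      using elim D_Suc(1,2)[OF elim(3), of n] by (auto simp: abs_le_iff)
    then have "(real (D (Suc n) \<omega>) - cD n \<omega>)\<^sup>2 \<le> (real C1)\<^sup>2" unfolding abs_le_square_iff .
    then show ?case
      by (simp add: power_mult_distrib divide_inverse power_inverse mult_right_mono del: of_nat_Suc)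
  qed
  show i: "integrable M (\<lambda>\<omega>. ((real (D (Suc n) \<omega>) - cD n \<omega>) / real (Suc n))\<^sup>2)" for n
    by (rule integrable_const_bound[OF b]) measurable
  have "(\<integral>\<omega>. ((real (D (Suc n) \<omega>) - cD n \<omega>) / real (Suc n))\<^sup>2 \<partial>M) \<le> (real C1)\<^sup>2 * inverse ((real (Suc n))\<^sup>2)" for n
  proof -
    have "(\<integral>\<omega>. ((real (D (Suc n) \<omega>) - cD n \<omega>) / real (Suc n))\<^sup>2 \<partial>M) \<le> (\<integral>\<omega>. (real C1)\<^sup>2 * inverse ((real (Suc n))\<^sup>2) \<partial>M)"
      by (rule integral_mono_AE[OF i]) (use b[of n] in auto)
    then show ?thesis by (simp add: prob_space)
  qed
  moreover have inv: "summable (\<lambda>n. inverse ((real (Suc n))\<^sup>2))"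
    by (rule summable_Suc_iff[THEN iffD2, of "\<lambda>n. inverse ((real n)\<^sup>2)", OF inverse_power_summable]) simp
  ultimately show "summable (\<lambda>n. \<integral>\<omega>. ((real (D (Suc n) \<omega>) - cD n \<omega>) / real (Suc n))\<^sup>2 \<partial>M)"
    by (intro summable_comparison_test'[OF summable_mult[OF inv], of 0]) simp
  show "(\<lambda>\<omega>. (real (D (Suc n) \<omega>) - cD n \<omega>) / real (Suc n)) \<in> borel_measurable (F (Suc n))" for n
    by (intro borel_measurable_divide borel_measurable_diff D_F F_mono_meas[OF cF]) auto
  show "(\<integral>\<omega>. f \<omega> * ((real (D (Suc n) \<omega>) - cD n \<omega>) / real (Suc n)) \<partial>M) = 0"
    if f: "f \<in> borel_measurable (F n)" "integrable M (\<lambda>\<omega>. (f \<omega>)\<^sup>2)" for n f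
  proof -
    interpret sigma_finite_subalgebra M "F n" by (rule sigma_finite_subalgebraI[OF subalgebra_F])
    have fi: "integrable M f" by (rule square_integrable_imp_integrable[OF F_sub_M_meas[OF f(1)] f(2)])
    have 1: "integrable M (\<lambda>\<omega>. f \<omega> * real (D (Suc n) \<omega>))"
      by (rule integrable_mult_bounded[OF fi D_M, of _ "real C1"]) (use D_Suc(2) in simp)
    note c = real_cond_exp_intg[OF 1 f(1) D_M]
    have "f \<omega> * ((real (D (Suc n) \<omega>) - cD n \<omega>) / real (Suc n)) =
      (f \<omega> * real (D (Suc n) \<omega>) - f \<omega> * cD n \<omega>) / real (Suc n)" for \<omega>
      by (simp only: right_diff_distrib times_divide_eq_right)
    then show ?thesis using Bochner_Integration.integral_diff[OF 1 c(1)] c(2) by simp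
  qed
qed (fact subalgebra_F F_mono)+

end

text \<open>An urn whose replacement factors have uniformly bounded second moments.\<close>

locale moment_bounded_urn = reinforced_urn +
  fixes C2 :: real
  assumes A_sq_int: "k \<in> {1..d} \<Longrightarrow> integrable M (\<lambda>\<omega>. (real (A (Suc n) k \<omega>))\<^sup>2)"
    and A_sq_le: "k \<in> {1..d} \<Longrightarrow> (\<integral>\<omega>. (real (A (Suc n) k \<omega>))\<^sup>2 \<partial>M) \<le> C2"
begin

text \<open>The index again counts completed stages: this is the mean replacement factor of stage \<^term>\<open>n + 1\<close>.\<close>

abbreviation "mu n k \<equiv> repl_mean M A (Suc n) k"

lemma A_int: "k \<in> {1..d} \<Longrightarrow> integrable M (\<lambda>\<omega>. real (A (Suc n) k \<omega>))"
  using square_integrable_imp_integrable[OF A_M A_sq_int] .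

lemma mu_ge_1:
  assumes "k \<in> {1..d}" shows "1 \<le> mu n k"
proof -
  have "(\<integral>\<omega>. 1 \<partial>M) \<le> (\<integral>\<omega>. real (A (Suc n) k \<omega>) \<partial>M)"
    using A_int[OF assms] A_ge[OF _ assms] by (intro integral_mono) force+
  then show ?thesis by (simp add: repl_mean_def prob_space)
qed

lemma centred_A:
  assumes k: "k \<in> {1..d}"
  shows "integrable M (\<lambda>\<omega>. (real (A (Suc n) k \<omega>) - mu n k)\<^sup>2)"
    and "(\<integral>\<omega>. (real (A (Suc n) k \<omega>) - mu n k)\<^sup>2 \<partial>M) = (\<integral>\<omega>. (real (A (Suc n) k \<omega>))\<^sup>2 \<partial>M) - (mu n k)\<^sup>2"
    and "integrable M (\<lambda>\<omega>. real (A (Suc n) k \<omega>) - mu n k)"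
    and "(\<integral>\<omega>. real (A (Suc n) k \<omega>) - mu n k \<partial>M) = 0"
proof -
  have e: "(real (A (Suc n) k \<omega>) - mu n k)\<^sup>2
      = (real (A (Suc n) k \<omega>))\<^sup>2 - 2 * mu n k * real (A (Suc n) k \<omega>) + (mu n k)\<^sup>2" for \<omega>
    by (simp add: power2_diff)
  note [simp] = A_int[OF k] A_sq_int[OF k]
  show "integrable M (\<lambda>\<omega>. (real (A (Suc n) k \<omega>) - mu n k)\<^sup>2)" unfolding e by auto
  show "(\<integral>\<omega>. (real (A (Suc n) k \<omega>) - mu n k)\<^sup>2 \<partial>M) = (\<integral>\<omega>. (real (A (Suc n) k \<omega>))\<^sup>2 \<partial>M) - (mu n k)\<^sup>2"
    unfolding e by (simp add: prob_space repl_mean_def[symmetric]) (simp add: power2_eq_square)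
  show "integrable M (\<lambda>\<omega>. real (A (Suc n) k \<omega>) - mu n k)" by auto
  show "(\<integral>\<omega>. real (A (Suc n) k \<omega>) - mu n k \<partial>M) = 0"
    by (simp add: prob_space repl_mean_def[symmetric])
qed

lemma mu_sq_le: "k \<in> {1..d} \<Longrightarrow> (mu n k)\<^sup>2 \<le> C2"
proof -
  assume k: "k \<in> {1..d}"
  have "0 \<le> (\<integral>\<omega>. (real (A (Suc n) k \<omega>) - mu n k)\<^sup>2 \<partial>M)" by simp
  then show ?thesis using centred_A(2)[OF k, of n] A_sq_le[OF k, of n] by linarith
qed

lemma replacement_fluctuations_summable:
  assumes k: "k \<in> {1..d}"
  shows "AE \<omega> in M. summable (\<lambda>n. (real (A (Suc n) k \<omega>) - mu n k) * (real (X (Suc n) k \<omega>) / real (H n k \<omega>)))"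
proof (rule martingale_differences_summable[where F=F])
  note sq = integral_A_mult[OF k _ integrable_X_over_H_sq[OF k], where g="\<lambda>a. (real a - mu n k)\<^sup>2" for n, OF _ centred_A(1)[OF k]]
  have XG: "(\<lambda>\<omega>. (real (X (Suc n) k \<omega>) / real (H n k \<omega>))\<^sup>2) \<in> borel_measurable (GX n)" for n
    by (intro borel_measurable_power X_over_H_GX k)
  show "(\<lambda>\<omega>. (real (A (Suc n) k \<omega>) - mu n k) * (real (X (Suc n) k \<omega>) / real (H n k \<omega>))) \<in> borel_measurable (F (Suc n))" for n
    by (intro borel_measurable_times borel_measurable_diff borel_measurable_divide borel_measurable_const
        A_F X_F F_mono_meas[OF H_F] k) auto
  show "integrable M (\<lambda>\<omega>. ((real (A (Suc n) k \<omega>) - mu n k) * (real (X (Suc n) k \<omega>) / real (H n k \<omega>)))\<^sup>2)" for n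
    unfolding power_mult_distrib using sq(1)[OF XG] .
  have "(\<integral>\<omega>. ((real (A (Suc n) k \<omega>) - mu n k) * (real (X (Suc n) k \<omega>) / real (H n k \<omega>)))\<^sup>2 \<partial>M)
    = (\<integral>\<omega>. (real (A (Suc n) k \<omega>) - mu n k)\<^sup>2 \<partial>M) * draw_ratio_sq k n" for n
    unfolding power_mult_distrib draw_ratio_sq_def using sq(2)[OF XG] .
  moreover have "(\<integral>\<omega>. (real (A (Suc n) k \<omega>) - mu n k)\<^sup>2 \<partial>M) * draw_ratio_sq k n \<le> C2 * draw_ratio_sq k n" for n
  proof (rule mult_right_mono)
    show "(\<integral>\<omega>. (real (A (Suc n) k \<omega>) - mu n k)\<^sup>2 \<partial>M) \<le> C2"
      using centred_A(2)[OF k, of n] A_sq_le[OF k, of n] zero_le_power2[of "mu n k"] by linarith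
  qed (simp add: draw_ratio_sq_def)
  ultimately show "summable (\<lambda>n. \<integral>\<omega>. ((real (A (Suc n) k \<omega>) - mu n k) * (real (X (Suc n) k \<omega>) / real (H n k \<omega>)))\<^sup>2 \<partial>M)"
    by (intro summable_comparison_test'[OF summable_mult[OF summable_draw_ratio_sq[OF k], of C2], of 0])
       (simp add: draw_ratio_sq_def)
  show "(\<integral>\<omega>. f \<omega> * ((real (A (Suc n) k \<omega>) - mu n k) * (real (X (Suc n) k \<omega>) / real (H n k \<omega>))) \<partial>M) = 0"
    if f: "f \<in> borel_measurable (F n)" "integrable M (\<lambda>\<omega>. (f \<omega>)\<^sup>2)" for n f
  proof -
    let ?Y = "\<lambda>\<omega>. f \<omega> * (real (X (Suc n) k \<omega>) / real (H n k \<omega>))"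
    have "integrable M f" by (rule square_integrable_imp_integrable[OF F_sub_M_meas[OF f(1)] f(2)])
    then have Yi: "integrable M ?Y"
      by (rule integrable_mult_bounded[OF _ X_over_H_M[OF k] X_over_H_bound[OF _ k]])
    have YG: "?Y \<in> borel_measurable (GX n)"
      by (intro borel_measurable_times X_over_H_GX k G_sub_GX_meas F_sub_G_meas f)
    have "(\<integral>\<omega>. (real (A (Suc n) k \<omega>) - mu n k) * ?Y \<omega> \<partial>M) = 0"
      using integral_A_mult(2)[OF k YG Yi, of "\<lambda>a. real a - mu n k", OF centred_A(3)[OF k]] centred_A(4)[OF k] by simp
    then show ?thesis by (simp add: mult.left_commute)
  qed
qed (fact subalgebra_F F_mono)+

lemma draw_fluctuations_summable:
  assumes k: "k \<in> {1..d}"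
  shows "AE \<omega> in M. summable (\<lambda>n. mu n k * (real (X (Suc n) k \<omega>) / real (H n k \<omega>) - real (D (Suc n) \<omega>) / real (S n \<omega>)))"
proof (rule martingale_differences_summable[where F=F])
  let ?U = "\<lambda>n \<omega>. real (X (Suc n) k \<omega>) / real (H n k \<omega>)" and ?V = "\<lambda>n \<omega>. real (D (Suc n) \<omega>) / real (S n \<omega>)"
  have VG: "?V n \<in> borel_measurable (G n)" for n
    by (intro borel_measurable_divide D_G F_sub_G_meas S_F)
  note UM [measurable] = X_over_H_M[OF k] and VM [measurable] = G_sub_M_meas[OF VG]
  have V1: "\<bar>?V n \<omega>\<bar> \<le> 1" if "\<omega> \<in> space M" for n \<omega>
    using D_Suc(1,3)[OF that, of n] by (simp add: divide_le_eq)
  have V2i: "integrable M (\<lambda>\<omega>. (?V n \<omega>)\<^sup>2)" for n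
    by (rule integrable_const_bound[of _ 1]) (use V1 VM in \<open>auto intro!: AE_I2 simp: abs_square_le_1\<close>)
  have Vi: "integrable M (?V n)" for n
    by (rule square_integrable_imp_integrable[OF VM V2i])
  have VUi: "integrable M (\<lambda>\<omega>. ?V n \<omega> * ?U n \<omega>)" for n
    by (rule integrable_mult_bounded[OF Vi UM X_over_H_bound[OF _ k]])
  have e: "(mu n k * (?U n \<omega> - ?V n \<omega>))\<^sup>2
      = (mu n k)\<^sup>2 * ((?U n \<omega>)\<^sup>2 - 2 * (?V n \<omega> * ?U n \<omega>) + (?V n \<omega>)\<^sup>2)" for n \<omega>
    unfolding power_mult_distrib power2_diff by (simp only: mult.commute mult.left_commute mult.assoc) (simp add: algebra_simps)
  show i: "integrable M (\<lambda>\<omega>. (mu n k * (?U n \<omega> - ?V n \<omega>))\<^sup>2)" for n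
    unfolding e
    by (intro integrable_mult_right Bochner_Integration.integrable_add Bochner_Integration.integrable_diff
        V2i VUi integrable_X_over_H_sq k)
  have "(\<integral>\<omega>. (mu n k * (?U n \<omega> - ?V n \<omega>))\<^sup>2 \<partial>M) \<le> C2 * draw_ratio_sq k n" for n
  proof -
    \<comment> \<open>The conditional mean of \<^term>\<open>?U n\<close> is \<^term>\<open>?V n\<close>, so subtracting it lowers the second moment.\<close>
    have "(\<integral>\<omega>. ?V n \<omega> * ?U n \<omega> \<partial>M) = (\<integral>\<omega>. (?V n \<omega>)\<^sup>2 \<partial>M)"
      unfolding power2_eq_square by (rule integral_mult_X_over_H[OF k VG Vi])
    then have "(\<integral>\<omega>. (?U n \<omega>)\<^sup>2 - 2 * (?V n \<omega> * ?U n \<omega>) + (?V n \<omega>)\<^sup>2 \<partial>M) = draw_ratio_sq k n - (\<integral>\<omega>. (?V n \<omega>)\<^sup>2 \<partial>M)"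
      using V2i[of n] VUi[of n] integrable_X_over_H_sq[OF k, of n] unfolding draw_ratio_sq_def
      by (subst Bochner_Integration.integral_add) (auto simp del: times_divide_eq_left times_divide_eq_right)
    moreover have "0 \<le> (\<integral>\<omega>. (?V n \<omega>)\<^sup>2 \<partial>M)" by simp
    ultimately have "(\<integral>\<omega>. (?U n \<omega>)\<^sup>2 - 2 * (?V n \<omega> * ?U n \<omega>) + (?V n \<omega>)\<^sup>2 \<partial>M) \<le> draw_ratio_sq k n" by linarith
    then have "(\<integral>\<omega>. (mu n k * (?U n \<omega> - ?V n \<omega>))\<^sup>2 \<partial>M) \<le> (mu n k)\<^sup>2 * draw_ratio_sq k n"
      unfolding e integral_mult_right_zero by (intro mult_left_mono) auto
    also have "\<dots> \<le> C2 * draw_ratio_sq k n" by (intro mult_right_mono mu_sq_le k) (simp add: draw_ratio_sq_def)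
    finally show ?thesis .
  qed
  then show "summable (\<lambda>n. \<integral>\<omega>. (mu n k * (?U n \<omega> - ?V n \<omega>))\<^sup>2 \<partial>M)"
    by (intro summable_comparison_test'[OF summable_mult[OF summable_draw_ratio_sq[OF k], of C2], of 0]) simp
  have UF: "?U n \<in> borel_measurable (F (Suc n))" for n
    by (rule borel_measurable_divide[OF X_F F_mono_meas[OF H_F]]) (use k in auto)
  have VF: "?V n \<in> borel_measurable (F (Suc n))" for n
    by (rule borel_measurable_divide[OF D_F F_mono_meas[OF S_F]]) auto
  show "(\<lambda>\<omega>. mu n k * (?U n \<omega> - ?V n \<omega>)) \<in> borel_measurable (F (Suc n))" for n
    by (rule borel_measurable_times[OF borel_measurable_const borel_measurable_diff[OF UF VF]])
  show "(\<integral>\<omega>. f \<omega> * (mu n k * (?U n \<omega> - ?V n \<omega>)) \<partial>M) = 0"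
    if f: "f \<in> borel_measurable (F n)" "integrable M (\<lambda>\<omega>. (f \<omega>)\<^sup>2)" for n f
  proof -
    have fi: "integrable M f" by (rule square_integrable_imp_integrable[OF F_sub_M_meas[OF f(1)] f(2)])
    have 1: "integrable M (\<lambda>\<omega>. f \<omega> * ?U n \<omega>)"
      by (rule integrable_mult_bounded[OF fi UM X_over_H_bound[OF _ k]])
    have 2: "integrable M (\<lambda>\<omega>. f \<omega> * ?V n \<omega>)"
      by (rule integrable_mult_bounded[OF fi VM V1])
    have eq: "f \<omega> * (mu n k * (?U n \<omega> - ?V n \<omega>)) = mu n k * (f \<omega> * ?U n \<omega> - f \<omega> * ?V n \<omega>)" for \<omega>
      by (simp only: right_diff_distrib mult.left_commute)
    show ?thesis
      unfolding eq using Bochner_Integration.integral_diff[OF 1 2] integral_mult_X_over_H[OF k F_sub_G_meas[OF f(1)] fi] by simp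
  qed
qed (fact subalgebra_F F_mono)+

lemma squared_increments_summable:
  assumes k: "k \<in> {1..d}"
  shows "AE \<omega> in M. summable (\<lambda>n. (real (A (Suc n) k \<omega>) * real (X (Suc n) k \<omega>) / real (H n k \<omega>))\<^sup>2)"
proof (rule AE_summable_of_summable_integrals)
  have XG: "(\<lambda>\<omega>. (real (X (Suc n) k \<omega>) / real (H n k \<omega>))\<^sup>2) \<in> borel_measurable (GX n)" for n
    by (intro borel_measurable_power X_over_H_GX k)
  note sq = integral_A_mult[OF k XG integrable_X_over_H_sq[OF k], of "\<lambda>a. (real a)\<^sup>2", OF A_sq_int[OF k]]
  have e: "(real (A (Suc n) k \<omega>) * real (X (Suc n) k \<omega>) / real (H n k \<omega>))\<^sup>2
     = (real (A (Suc n) k \<omega>))\<^sup>2 * (real (X (Suc n) k \<omega>) / real (H n k \<omega>))\<^sup>2" for n \<omega>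
    by (simp add: power_mult_distrib power_divide)
  show "integrable M (\<lambda>\<omega>. (real (A (Suc n) k \<omega>) * real (X (Suc n) k \<omega>) / real (H n k \<omega>))\<^sup>2)" for n
    unfolding e by (rule sq(1))
  have "(\<integral>\<omega>. (real (A (Suc n) k \<omega>) * real (X (Suc n) k \<omega>) / real (H n k \<omega>))\<^sup>2 \<partial>M) \<le> C2 * draw_ratio_sq k n" for n
    unfolding e sq(2) draw_ratio_sq_def by (intro mult_right_mono A_sq_le k) simp
  then show "summable (\<lambda>n. \<integral>\<omega>. (real (A (Suc n) k \<omega>) * real (X (Suc n) k \<omega>) / real (H n k \<omega>))\<^sup>2 \<partial>M)"
    by (intro summable_comparison_test'[OF summable_mult[OF summable_draw_ratio_sq[OF k], of C2], of 0]) simp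
qed simp

end

section \<open>The limit theorem\<close>

text \<open>For natural-number-valued variables the square is dominated by the cube.\<close>

lemma second_moment_le_third:
  fixes Y :: "'a \<Rightarrow> nat"
  assumes Y: "Y \<in> measurable M (count_space UNIV)"
    and b: "(\<integral>\<^sup>+\<omega>. ennreal (real (Y \<omega>) ^ 3) \<partial>M) \<le> ennreal C"
  shows "integrable M (\<lambda>\<omega>. (real (Y \<omega>))\<^sup>2)" "(\<integral>\<omega>. (real (Y \<omega>))\<^sup>2 \<partial>M) \<le> max 0 C"
proof -
  have m: "(\<lambda>\<omega>. real (Y \<omega>)) \<in> borel_measurable M"
    by (rule measurable_compose[OF Y]) simp
  have "real (Y \<omega>) ^ 2 \<le> real (Y \<omega>) ^ 3" for \<omega>
    by (cases "Y \<omega> = 0") (auto intro!: power_increasing)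
  then have "(\<integral>\<^sup>+\<omega>. ennreal ((real (Y \<omega>))\<^sup>2) \<partial>M) \<le> (\<integral>\<^sup>+\<omega>. ennreal (real (Y \<omega>) ^ 3) \<partial>M)"
    by (intro nn_integral_mono ennreal_leI)
  also note b
  finally have le: "(\<integral>\<^sup>+\<omega>. ennreal ((real (Y \<omega>))\<^sup>2) \<partial>M) \<le> ennreal C" .
  show i: "integrable M (\<lambda>\<omega>. (real (Y \<omega>))\<^sup>2)"
  proof (rule integrableI_bounded)
    show "(\<lambda>\<omega>. (real (Y \<omega>))\<^sup>2) \<in> borel_measurable M" using m by (rule borel_measurable_power)
    show "(\<integral>\<^sup>+\<omega>. ennreal (norm ((real (Y \<omega>))\<^sup>2)) \<partial>M) < \<infinity>"
      using le_less_trans[OF le ennreal_less_top] by simp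
  qed
  have "ennreal (\<integral>\<omega>. (real (Y \<omega>))\<^sup>2 \<partial>M) = (\<integral>\<^sup>+\<omega>. ennreal ((real (Y \<omega>))\<^sup>2) \<partial>M)"
    by (rule nn_integral_eq_integral[symmetric, OF i]) simp
  also have "\<dots> \<le> ennreal (max 0 C)" using le by (rule order.trans) (rule ennreal_leI, simp)
  finally show "(\<integral>\<omega>. (real (Y \<omega>))\<^sup>2 \<partial>M) \<le> max 0 C"
    by (rule ennreal_le_iff[THEN iffD1, rotated]) simp
qed

theorem theorem3p7:
  fixes M :: "'a measure" and d t C1 :: nat and H0 :: "nat \<Rightarrow> nat"
    and D :: "nat \<Rightarrow> 'a \<Rightarrow> nat" and X A :: "nat \<Rightarrow> nat \<Rightarrow> 'a \<Rightarrow> nat"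
    and C2 :: real and m :: "nat \<Rightarrow> real" and N :: "'a \<Rightarrow> real"
  assumes urn: "reinforced_urn M d H0 D X A C1"
    and A1: "\<forall>k\<in>{1..d}. (SUP n\<in>{1..}. \<integral>\<^sup>+\<omega>. ennreal (real (A n k \<omega>) ^ 3) \<partial>M) < ennreal C2"
    and A2_lim: "\<forall>k\<in>{1..d}. (\<lambda>n. repl_mean M A n k) \<longlonglongrightarrow> m k"
    and A2_t: "t \<in> {1..d}"
    and A2_eq: "\<forall>k\<in>{1..t}. m k = m 1"
    and A2_gt: "\<forall>k\<in>{t+1..d}. m k < m 1"
    and A2_ge: "\<forall>k\<in>{t+1..d}. \<forall>l\<in>{k..d}. m l \<le> m k"
    and A2_mean: "\<forall>n\<ge>1. \<forall>k\<in>{1..t}. repl_mean M A n k = repl_mean M A n 1"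
    and A3: "\<forall>k\<in>{1..d}. \<forall>j\<in>{1..d}. summable (\<lambda>i. let n = i + 1 in
      \<bar>repl_mean M A (n + 1) k * m j - m k * repl_mean M A (n + 1) j\<bar> / real n)"
    and N_rv: "N \<in> borel_measurable M"
    and N_lim: "AE \<omega> in M.
      (\<lambda>n. real_cond_exp M (urn_F M d D X A n) (\<lambda>\<omega>. real (D (n + 1) \<omega>)) \<omega>) \<longlonglongrightarrow> N \<omega>"
  shows "\<exists>(Z :: nat \<Rightarrow> 'a \<Rightarrow> real) (xi :: nat \<Rightarrow> 'a \<Rightarrow> real) (Zt :: nat \<Rightarrow> 'a \<Rightarrow> real).
    (\<forall>k\<in>{1..d}. Z k \<in> borel_measurable M \<and>
      (AE \<omega> in M. (\<lambda>n. urn_Z d H0 X A n k \<omega>) \<longlonglongrightarrow> Z k \<omega>)) \<and>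
    (\<forall>j\<in>{t+1..d}. xi j \<in> borel_measurable M \<and> (AE \<omega> in M. 0 < xi j \<omega>) \<and>
      (AE \<omega> in M. (\<lambda>n. real (urn_H H0 X A n j \<omega>) / real (urn_H H0 X A n 1 \<omega>) powr (m j / m 1))
        \<longlonglongrightarrow> xi j \<omega>)) \<and>
    (\<forall>j\<in>{t+1..d}. Zt j \<in> borel_measurable M \<and>
      (AE \<omega> in M. (\<lambda>n. real n powr (1 - m j / m 1) * urn_Z d H0 X A n j \<omega>) \<longlonglongrightarrow> Zt j \<omega>) \<and>
      (AE \<omega> in M. Zt j \<omega> = xi j \<omega> * Z 1 \<omega> powr (m j / m 1) / (N \<omega> * m 1) powr (1 - m j / m 1)) \<and>
      measure M {\<omega> \<in> space M. Zt j \<omega> \<in> {0<..}} = 1) \<and>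
    (\<forall>j\<in>{t+1..d}. AE \<omega> in M.
      (\<lambda>n. real (urn_H H0 X A n j \<omega>) / real n powr (m j / m 1))
        \<longlonglongrightarrow> (N \<omega> * m 1 * Z 1 \<omega>) powr (m j / m 1) * xi j \<omega>) \<and>
    (\<forall>k\<in>{1..d}. AE \<omega> in M.
      (\<lambda>n. real (urn_drawn X n k \<omega>) / real n powr (m k / m 1))
        \<longlonglongrightarrow> (if k \<in> {1..t} then N \<omega> * Z k \<omega> else m 1 / m k * N \<omega> * Zt k \<omega>))"
proof -
  interpret U: reinforced_urn M d H0 D X A C1 by (rule urn)
  have third: "(\<integral>\<^sup>+\<omega>. ennreal (real (A (Suc n) k \<omega>) ^ 3) \<partial>M) \<le> ennreal C2" if "k \<in> {1..d}" for n k
  proof -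
    have "(\<integral>\<^sup>+\<omega>. ennreal (real (A (Suc n) k \<omega>) ^ 3) \<partial>M) \<le> (SUP n\<in>{1..}. \<integral>\<^sup>+\<omega>. ennreal (real (A n k \<omega>) ^ 3) \<partial>M)"
      by (rule SUP_upper) simp
    also have "\<dots> \<le> ennreal C2" using A1 that by (auto intro: less_imp_le)
    finally show ?thesis .
  qed
  have A_meas: "A (Suc n) k \<in> measurable M (count_space UNIV)" if "k \<in> {1..d}" for n k
    using U.A_rv that by simp
  interpret V: moment_bounded_urn M d H0 D X A C1 "max 0 C2"
    by standard (rule second_moment_le_third[OF A_meas third]; assumption)+
  have one: "1 \<in> {1..d}" using U.colours by simp
  have Suc_sum: "(\<Sum>i=1..n. f i) = (\<Sum>i<n. f (Suc i))" for f :: "nat \<Rightarrow> real" and n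
    using sum.atLeast1_atMost_eq[of f n] by simp
  have H_eq: "real (U.H n k \<omega>) = real (H0 k) + (\<Sum>i<n. real (A (Suc i) k \<omega>) * real (X (Suc i) k \<omega>))" for n k \<omega>
    unfolding urn_H_def of_nat_add of_nat_sum of_nat_mult Suc_sum ..
  have S_eq: "real (U.S n \<omega>) = (\<Sum>j=1..d. real (H0 j) + (\<Sum>i<n. real (A (Suc i) j \<omega>) * real (X (Suc i) j \<omega>)))" for n \<omega>
    unfolding urn_S_def of_nat_sum H_eq ..
  have drawn_eq: "real (urn_drawn X n k \<omega>) = (\<Sum>i<n. real (X (Suc i) k \<omega>))" for n k \<omega>
    unfolding urn_drawn_def of_nat_sum Suc_sum ..
  let ?R = "\<lambda>\<omega> k n. real (U.H n k \<omega>) / real (U.H n 1 \<omega>) powr (m k / m 1)"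
  \<comment> \<open>As a \<^const>\<open>lim\<close> of measurable functions, \<^term>\<open>Z\<close> and \<^term>\<open>xi\<close> are measurable; their values
    on the null set of divergence are irrelevant. \<^term>\<open>Zt\<close> is defined by its claimed formula.\<close>
  define Z where "Z k \<omega> = lim (\<lambda>n. urn_Z d H0 X A n k \<omega>)" for k \<omega>
  define xi where "xi j \<omega> = lim (?R \<omega> j)" for j \<omega>
  define Zt where "Zt j \<omega> = xi j \<omega> * Z 1 \<omega> powr (m j / m 1) / (N \<omega> * m 1) powr (1 - m j / m 1)" for j \<omega>
  have Z_rv: "Z k \<in> borel_measurable M" if "k \<in> {1..d}" for k
    unfolding Z_def[abs_def] urn_Z_def
    by (intro borel_measurable_lim_metric borel_measurable_divide U.H_M U.S_M that)
  have xi_rv: "xi j \<in> borel_measurable M" if "j \<in> {1..d}" for j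
    unfolding xi_def[abs_def]
    by (intro borel_measurable_lim_metric borel_measurable_divide powr_real_measurable
        borel_measurable_const U.H_M that one)
  have Zt_rv: "Zt j \<in> borel_measurable M" if "j \<in> {1..d}" for j
    unfolding Zt_def[abs_def]
    by (intro borel_measurable_times borel_measurable_divide powr_real_measurable
        borel_measurable_const N_rv Z_rv xi_rv that one)
  have m1: "1 \<le> m 1"
    by (rule LIMSEQ_le_const[OF LIMSEQ_Suc[OF A2_lim[rule_format, OF one]]]) (use V.mu_ge_1[OF one] in auto)
  \<comment> \<open>The part of the claim that speaks of a single outcome.\<close>
  define good where "good \<omega> \<longleftrightarrow> 0 < N \<omega> \<and> (\<forall>k\<in>{1..d}. (\<lambda>n. urn_Z d H0 X A n k \<omega>) \<longlonglongrightarrow> Z k \<omega>) \<and> 0 < Z 1 \<omega> \<and>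
    (\<forall>j\<in>{t+1..d}. 0 < xi j \<omega> \<and> ?R \<omega> j \<longlonglongrightarrow> xi j \<omega> \<and>
       (\<lambda>n. real n powr (1 - m j / m 1) * urn_Z d H0 X A n j \<omega>) \<longlonglongrightarrow> Zt j \<omega> \<and>
       (\<lambda>n. real (U.H n j \<omega>) / real n powr (m j / m 1)) \<longlonglongrightarrow> (N \<omega> * m 1 * Z 1 \<omega>) powr (m j / m 1) * xi j \<omega>) \<and>
    (\<forall>k\<in>{1..d}. (\<lambda>n. real (urn_drawn X n k \<omega>) / real n powr (m k / m 1))
        \<longlonglongrightarrow> (if k \<in> {1..t} then N \<omega> * Z k \<omega> else m 1 / m k * N \<omega> * Zt k \<omega>))" for \<omega>
  have 1: "AE \<omega> in M. \<forall>k\<in>{1..d}. summable (\<lambda>n. (real (A (Suc n) k \<omega>) - V.mu n k) * (real (X (Suc n) k \<omega>) / real (U.H n k \<omega>)))"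
    by (intro AE_finite_allI V.replacement_fluctuations_summable) auto
  have 2: "AE \<omega> in M. \<forall>k\<in>{1..d}. summable (\<lambda>n. V.mu n k * (real (X (Suc n) k \<omega>) / real (U.H n k \<omega>) - real (D (Suc n) \<omega>) / real (U.S n \<omega>)))"
    by (intro AE_finite_allI V.draw_fluctuations_summable) auto
  have 3: "AE \<omega> in M. \<forall>k\<in>{1..d}. summable (\<lambda>n. (real (A (Suc n) k \<omega>) * real (X (Suc n) k \<omega>) / real (U.H n k \<omega>))\<^sup>2)"
    by (intro AE_finite_allI V.squared_increments_summable) auto
  have 4: "AE \<omega> in M. \<forall>n. 1 \<le> U.cD n \<omega>"
    unfolding AE_all_countable by (intro allI U.cD_bounds)
  have "AE \<omega> in M. good \<omega>"
    using 1 2 3 4 U.draw_number_fluctuations_summable N_lim AE_space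
  proof eventually_elim
    case (elim \<omega>)
    have cl: "(\<lambda>n. U.cD n \<omega>) \<longlonglongrightarrow> N \<omega>" using elim(6) by simp
    have "1 \<le> N \<omega>" by (rule LIMSEQ_le_const[OF cl]) (use elim(4) in auto)
    then have Npos: "0 < N \<omega>" by simp
    interpret P: urn_path d "\<lambda>k. real (H0 k)" "\<lambda>n k. real (A (Suc n) k \<omega>)" "\<lambda>n k. real (X (Suc n) k \<omega>)"
      V.mu "\<lambda>n. real (D (Suc n) \<omega>)" "\<lambda>n. U.cD n \<omega>" m "N \<omega>" "real C1"
    proof
      show "0 < N \<omega>" by (rule Npos)
      show "(\<lambda>n. U.cD n \<omega>) \<longlonglongrightarrow> N \<omega>" by (rule cl)
      show "summable (\<lambda>n. (real (D (Suc n) \<omega>) - U.cD n \<omega>) / real (Suc n))" by (rule elim(5))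
      fix n
      show "(\<Sum>k=1..d. real (X (Suc n) k \<omega>)) = real (D (Suc n) \<omega>)"
        unfolding U.X_sum_Suc[OF elim(7), symmetric] by simp
      show "1 \<le> real (D (Suc n) \<omega>)" "real (D (Suc n) \<omega>) \<le> real C1"
        using U.D_Suc[OF elim(7), of n] by simp_all
    next
      fix k assume k: "k \<in> {1..d}"
      show "0 < real (H0 k)" using U.initial k by simp
      show "0 \<le> real (X (Suc n) k \<omega>)" for n by simp
      show "1 \<le> real (A (Suc n) k \<omega>)" for n using U.A_ge[OF elim(7) k, of n] by simp
      show "1 \<le> V.mu n k" for n by (rule V.mu_ge_1[OF k])
      show "(\<lambda>n. V.mu n k) \<longlonglongrightarrow> m k" by (rule LIMSEQ_Suc[OF A2_lim[rule_format, OF k]])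
      show "summable (\<lambda>n. \<bar>V.mu (Suc n) k * m j - m k * V.mu (Suc n) j\<bar> / real (Suc n))" if "j \<in> {1..d}" for j
        using A3[rule_format, OF k that] by (simp add: Let_def)
      show "summable (\<lambda>n. (real (A (Suc n) k \<omega>) - V.mu n k) * real (X (Suc n) k \<omega>) /
          (real (H0 k) + (\<Sum>i<n. real (A (Suc i) k \<omega>) * real (X (Suc i) k \<omega>))))"
        using elim(1)[rule_format, OF k] unfolding H_eq times_divide_eq_right .
      show "summable (\<lambda>n. V.mu n k * (real (X (Suc n) k \<omega>) /
          (real (H0 k) + (\<Sum>i<n. real (A (Suc i) k \<omega>) * real (X (Suc i) k \<omega>))) -
          real (D (Suc n) \<omega>) / (\<Sum>j=1..d. real (H0 j) + (\<Sum>i<n. real (A (Suc i) j \<omega>) * real (X (Suc i) j \<omega>)))))"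
        using elim(2)[rule_format, OF k] unfolding H_eq S_eq .
      show "summable (\<lambda>n. (real (A (Suc n) k \<omega>) * real (X (Suc n) k \<omega>) /
          (real (H0 k) + (\<Sum>i<n. real (A (Suc i) k \<omega>) * real (X (Suc i) k \<omega>))))\<^sup>2)"
        using elim(3)[rule_format, OF k] unfolding H_eq .
    qed
    have h: "P.h n k = real (U.H n k \<omega>)" for n k unfolding P.h_def H_eq ..
    have s: "P.s n = real (U.S n \<omega>)" for n unfolding P.s_def P.h_def S_eq ..
    obtain z x where L: "\<forall>k\<in>{1..d}. (\<lambda>n. urn_Z d H0 X A n k \<omega>) \<longlonglongrightarrow> z k" "0 < z 1"
      "\<forall>j\<in>{t+1..d}. 0 < x j \<and> ?R \<omega> j \<longlonglongrightarrow> x j \<and>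
         (\<lambda>n. real n powr (1 - m j / m 1) * urn_Z d H0 X A n j \<omega>)
           \<longlonglongrightarrow> x j * z 1 powr (m j / m 1) / (N \<omega> * m 1) powr (1 - m j / m 1) \<and>
         (\<lambda>n. real (U.H n j \<omega>) / real n powr (m j / m 1)) \<longlonglongrightarrow> (N \<omega> * m 1 * z 1) powr (m j / m 1) * x j"
      "\<forall>k\<in>{1..d}. (\<lambda>n. real (urn_drawn X n k \<omega>) / real n powr (m k / m 1)) \<longlonglongrightarrow>
         (if k \<in> {1..t} then N \<omega> * z k
          else m 1 / m k * N \<omega> * (x k * z 1 powr (m k / m 1) / (N \<omega> * m 1) powr (1 - m k / m 1)))"
      using P.limits[OF A2_t A2_eq[rule_format] A2_gt[rule_format]]
      unfolding h s urn_Z_def[symmetric] drawn_eq[symmetric] by blast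
    have z: "z k = Z k \<omega>" if "k \<in> {1..d}" for k
      unfolding Z_def using limI[OF L(1)[rule_format, OF that]] by simp
    have x: "x j = xi j \<omega>" if "j \<in> {t+1..d}" for j
      unfolding xi_def by (rule limI[symmetric]) (use L(3) that in blast)
    note z1 = z[OF one]
    show ?case
      unfolding good_def
    proof (intro conjI ballI)
      show "0 < N \<omega>" by (rule Npos)
      show "0 < Z 1 \<omega>" using L(2) unfolding z1 .
      show "(\<lambda>n. urn_Z d H0 X A n k \<omega>) \<longlonglongrightarrow> Z k \<omega>" if "k \<in> {1..d}" for k
        using L(1)[rule_format, OF that] unfolding z[OF that] .
    next
      fix j assume j: "j \<in> {t+1..d}"
      note Lj = L(3)[rule_format, OF j, unfolded x[OF j] z1]
      show "0 < xi j \<omega>" using Lj by blast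
      show "?R \<omega> j \<longlonglongrightarrow> xi j \<omega>" using Lj by blast
      show "(\<lambda>n. real n powr (1 - m j / m 1) * urn_Z d H0 X A n j \<omega>) \<longlonglongrightarrow> Zt j \<omega>"
        unfolding Zt_def using Lj by blast
      show "(\<lambda>n. real (U.H n j \<omega>) / real n powr (m j / m 1))
          \<longlonglongrightarrow> (N \<omega> * m 1 * Z 1 \<omega>) powr (m j / m 1) * xi j \<omega>" using Lj by blast
    next
      fix k assume k: "k \<in> {1..d}"
      note Lk = L(4)[rule_format, OF k, unfolded z[OF k] z1]
      show "(\<lambda>n. real (urn_drawn X n k \<omega>) / real n powr (m k / m 1))
        \<longlonglongrightarrow> (if k \<in> {1..t} then N \<omega> * Z k \<omega> else m 1 / m k * N \<omega> * Zt k \<omega>)"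
      proof (cases "k \<in> {1..t}")
        case True
        show ?thesis using Lk unfolding if_P[OF True] .
      next
        case False
        then have "k \<in> {t+1..d}" using k by auto
        from x[OF this] show ?thesis using Lk unfolding if_not_P[OF False] Zt_def by (simp only:)
      qed
    qed
  qed
  note G = this[unfolded good_def]
  have sub: "j \<in> {1..d}" if "j \<in> {t+1..d}" for j using that by auto
  have pos: "measure M {\<omega> \<in> space M. Zt j \<omega> \<in> {0<..}} = 1" if j: "j \<in> {t+1..d}" for j
  proof -
    have "AE \<omega> in M. Zt j \<omega> \<in> {0<..}"
      using G
    proof eventually_elim
      case (elim \<omega>)
      have "0 < xi j \<omega>" "0 < Z 1 \<omega>" "0 < N \<omega>" using elim j by blast+
      then show ?case using m1 by (simp add: Zt_def)
    qed
    moreover have "{\<omega> \<in> space M. Zt j \<omega> \<in> {0<..}} \<in> sets M"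
      using Zt_rv[OF sub[OF j]] by measurable
    ultimately show ?thesis by (simp add: U.prob_Collect_eq_1)
  qed
  show ?thesis
  proof (rule exI[of _ Z], rule exI[of _ xi], rule exI[of _ Zt], intro conjI ballI)
    fix k assume k: "k \<in> {1..d}"
    show "Z k \<in> borel_measurable M" by (rule Z_rv[OF k])
    show "AE \<omega> in M. (\<lambda>n. urn_Z d H0 X A n k \<omega>) \<longlonglongrightarrow> Z k \<omega>"
      by (rule eventually_mono[OF G]) (use k in blast)
    show "AE \<omega> in M. (\<lambda>n. real (urn_drawn X n k \<omega>) / real n powr (m k / m 1))
        \<longlonglongrightarrow> (if k \<in> {1..t} then N \<omega> * Z k \<omega> else m 1 / m k * N \<omega> * Zt k \<omega>)"
      by (rule eventually_mono[OF G]) (use k in blast)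
  next
    fix j assume j: "j \<in> {t+1..d}"
    show "xi j \<in> borel_measurable M" by (rule xi_rv[OF sub[OF j]])
    show "Zt j \<in> borel_measurable M" by (rule Zt_rv[OF sub[OF j]])
    show "AE \<omega> in M. 0 < xi j \<omega>" by (rule eventually_mono[OF G]) (use j in blast)
    show "AE \<omega> in M. ?R \<omega> j \<longlonglongrightarrow> xi j \<omega>" by (rule eventually_mono[OF G]) (use j in blast)
    show "AE \<omega> in M. (\<lambda>n. real n powr (1 - m j / m 1) * urn_Z d H0 X A n j \<omega>) \<longlonglongrightarrow> Zt j \<omega>"
      by (rule eventually_mono[OF G]) (use j in blast)
    show "AE \<omega> in M. Zt j \<omega> = xi j \<omega> * Z 1 \<omega> powr (m j / m 1) / (N \<omega> * m 1) powr (1 - m j / m 1)"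
      by (simp add: Zt_def)
    show "measure M {\<omega> \<in> space M. Zt j \<omega> \<in> {0<..}} = 1" by (rule pos[OF j])
    show "AE \<omega> in M. (\<lambda>n. real (U.H n j \<omega>) / real n powr (m j / m 1))
        \<longlonglongrightarrow> (N \<omega> * m 1 * Z 1 \<omega>) powr (m j / m 1) * xi j \<omega>"
      by (rule eventually_mono[OF G]) (use j in blast)
  qed
qed

end
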